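(* Let $T$ be an integral domain with $|T|=2^{2^{\aleph_0}}$ and Krull dimension $\dim(T)=1$. Then $T$ has a maximal subring.
   Context: All rings are commutative with $1\neq0$ and subrings are unital. A maximal subring of $T$ is a proper subring maximal with respect to inclusion among proper subrings of $T$. *)

theory Defs
  imports "HOL-Algebra.Algebra" "HOL-Library.Equipollence" "HOL-Library.Extended_Nat"
begin

definition prime_chain :: "('a, 'b) ring_scheme \<Rightarrow> nat \<Rightarrow> bool" where
  "prime_chain R n \<longleftrightarrow>
     (\<exists>P :: nat \<Rightarrow> 'a set. (\<forall>i\<le>n. primeideal (P i) R) \<and> (\<forall>i<n. P i \<subset> P (Suc i)))"

definition krull_dim :: "('a, 'b) ring_scheme \<Rightarrow> enat" where
  "krull_dim R = Sup {enat n | n. prime_chain R n}"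

definition maximal_subring :: "'a set \<Rightarrow> ('a, 'b) ring_scheme \<Rightarrow> bool" where
  "maximal_subring S R \<longleftrightarrow>
     subring S R \<and> S \<noteq> carrier R \<and>
     (\<forall>S'. subring S' R \<and> S \<subseteq> S' \<and> S' \<noteq> carrier R \<longrightarrow> S' = S)"

end

theory Submission
  imports Defs "HOL-Library.Countable_Set"
begin

text \<open>
  Let \<open>T\<close> have no maximal subring. The main tool is that a domain with a unit \<open>u\<close> transcendental over some
  subring has a maximal subring: choose a subring \<open>P\<close> maximal among those over which \<open>u\<close> is
  transcendental; then \<open>u\<close> is a prime element of \<open>P[u]\<close> with no nonzero element divisible by all
  powers of \<open>u\<close>, the domain is algebraic over \<open>P[u]\<close>, and an argument in the style of Chevalley's
  extension theorem yields a subring \<open>S\<close> not containing \<open>1/u\<close> in which every element lands after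
  multiplication by a power of \<open>u\<close>. A subring that contains \<open>S\<close> and is maximal without \<open>1/u\<close> is then
  a maximal subring.

  Applied to \<open>T/M\<close> and to the units \<open>1 + ax\<close> with \<open>a\<close> in the Jacobson radical, this shows that all
  residue fields of \<open>T\<close> are countable, that the Jacobson radical vanishes, and that, for \<open>t\<close>
  transcendental over a countable subring \<open>K\<close>, every maximal ideal contains a nonzero element of the
  countable ring \<open>K[t]\<close>. Two different maximal ideals cannot have isomorphic residue fields, since
  otherwise the equalizer of the two maps to the common field would be a maximal subring; so
  there are at most continuum many maximal ideals. For \<open>d \<noteq> 0\<close> the spectrum of \<open>T/(d)\<close> is a Boolean
  space because \<open>dim T = 1\<close>, and compactness bounds \<open>T/rad(d)\<close> by the continuum as well. Finally \<open>T\<close>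
  embeds into the product of the rings \<open>T/rad(d)\<close> over the countably many nonzero \<open>d \<in> K[t]\<close>, hence has
  at most continuum many elements.
\<close>

section \<open>Polynomial expressions and Zorn's lemma for subrings\<close>

text \<open>Two elements of the union of a chain lie in one member, so the union is again a subring
  and Zorn's lemma applies. The property \<open>Q\<close> will be: avoiding \<open>1/x\<close>,
  creating no new quotients by \<open>x\<close>, keeping a unit transcendental.\<close>

lemma (in ring) subring_maximal_exists:
  assumes "subring A R" and "Q A"
    and chain: "\<And>C. C \<noteq> {} \<Longrightarrow> (\<And>S. S \<in> C \<Longrightarrow> subring S R \<and> A \<subseteq> S \<and> Q S) \<Longrightarrow>
                  (\<And>S S'. S \<in> C \<Longrightarrow> S' \<in> C \<Longrightarrow> S \<subseteq> S' \<or> S' \<subseteq> S) \<Longrightarrow> Q (\<Union>C)"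
  obtains M where "subring M R" "A \<subseteq> M" "Q M"
    "\<And>S. subring S R \<Longrightarrow> M \<subseteq> S \<Longrightarrow> Q S \<Longrightarrow> S = M"
proof -
  let ?\<A> = "{S. subring S R \<and> A \<subseteq> S \<and> Q S}"
  have "\<exists>M\<in>?\<A>. \<forall>S\<in>?\<A>. M \<subseteq> S \<longrightarrow> S = M"
  proof (rule subset_Zorn_nonempty)
    show "?\<A> \<noteq> {}" using assms(1,2) by blast
  next
    fix C assume C0: "C \<noteq> {}" and "subset.chain ?\<A> C"
    then have C: "S \<in> C \<Longrightarrow> subring S R \<and> A \<subseteq> S \<and> Q S"
      and lin: "S \<in> C \<Longrightarrow> S' \<in> C \<Longrightarrow> S \<subseteq> S' \<or> S' \<subseteq> S" for S S'
      by (auto simp: subset_chain_def)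
    have dir: "\<exists>S\<in>C. a \<in> S \<and> b \<in> S" if ab: "a \<in> \<Union>C" "b \<in> \<Union>C" for a b
    proof -
      obtain S S' where "S \<in> C" "a \<in> S" "S' \<in> C" "b \<in> S'" using ab by blast
      then show ?thesis using lin[of S S'] by blast
    qed
    have sub: "\<And>S. S \<in> C \<Longrightarrow> subring S R" using C by blast
    obtain S0 where S0: "S0 \<in> C" using C0 by blast
    have "subring (\<Union>C) R"
    proof (rule subringI)
      show "\<Union>C \<subseteq> carrier R" using subringE(1)[OF sub] by blast
      show "\<one> \<in> \<Union>C" using subringE(3)[OF sub[OF S0]] S0 by blast
      show "\<ominus> h \<in> \<Union>C" if "h \<in> \<Union>C" for h
        using that subringE(5)[OF sub, of _ h] by (elim UnionE) (intro UnionI)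
      show "h1 \<otimes> h2 \<in> \<Union>C" if "h1 \<in> \<Union>C" "h2 \<in> \<Union>C" for h1 h2
      proof -
        obtain S where S: "S \<in> C" "h1 \<in> S" "h2 \<in> S" using dir[OF \<open>h1 \<in> \<Union>C\<close> \<open>h2 \<in> \<Union>C\<close>] by blast
        show ?thesis using subringE(6)[OF sub[OF S(1)] S(2,3)] S(1) by (rule UnionI[rotated])
      qed
      show "h1 \<oplus> h2 \<in> \<Union>C" if "h1 \<in> \<Union>C" "h2 \<in> \<Union>C" for h1 h2
      proof -
        obtain S where S: "S \<in> C" "h1 \<in> S" "h2 \<in> S" using dir[OF \<open>h1 \<in> \<Union>C\<close> \<open>h2 \<in> \<Union>C\<close>] by blast
        show ?thesis using subringE(7)[OF sub[OF S(1)] S(2,3)] S(1) by (rule UnionI[rotated])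
      qed
    qed
    moreover have "A \<subseteq> \<Union>C" using C[OF S0] S0 by blast
    moreover have "Q (\<Union>C)" using chain[OF C0 C lin] by blast
    ultimately show "\<Union>C \<in> ?\<A>" by blast
  qed
  then obtain M where M: "M \<in> ?\<A>" "\<forall>S\<in>?\<A>. M \<subseteq> S \<longrightarrow> S = M" by (elim bexE)
  then show ?thesis using that[of M] by auto
qed

text \<open>The values at \<open>t\<close> of the polynomials of degree less than \<open>n\<close> with coefficients in \<open>K\<close>.\<close>

primrec (in ring) poly_values :: "'a set \<Rightarrow> 'a \<Rightarrow> nat \<Rightarrow> 'a set" where
  "poly_values K t 0 = {\<zero>}"
| "poly_values K t (Suc n) = {w \<otimes> t \<oplus> r | w r. w \<in> poly_values K t n \<and> r \<in> K}"

section \<open>Arithmetic of polynomial values under a degree bound\<close>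

context cring
begin

lemma poly_values_SucI:
  "w \<in> poly_values K t n \<Longrightarrow> r \<in> K \<Longrightarrow> w \<otimes> t \<oplus> r \<in> poly_values K t (Suc n)"
  by auto

lemma poly_values_closed:
  assumes "K \<subseteq> carrier R" "t \<in> carrier R"
  shows "w \<in> poly_values K t n \<Longrightarrow> w \<in> carrier R"
  by (induction n arbitrary: w) (use assms in auto)

lemma poly_values_mono_Suc:
  assumes "subring K R" "t \<in> carrier R"
  shows "w \<in> poly_values K t n \<Longrightarrow> w \<in> poly_values K t (Suc n)"
proof (induction n arbitrary: w)
  case 0
  then show ?case using poly_values_SucI[of \<zero> K t 0 \<zero>] subringE(2)[OF assms(1)] assms(2) by simp
next
  case (Suc n)
  then obtain v r where "w = v \<otimes> t \<oplus> r" "v \<in> poly_values K t n" "r \<in> K" by auto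
  then show ?case using poly_values_SucI[OF Suc.IH] by blast
qed

lemma poly_values_mono:
  assumes "subring K R" "t \<in> carrier R" "m \<le> n"
  shows "w \<in> poly_values K t m \<Longrightarrow> w \<in> poly_values K t n"
  using assms(3) by (induction n rule: dec_induct) (use poly_values_mono_Suc[OF assms(1,2)] in blast)+

lemma poly_values_add:
  assumes "subring K R" "t \<in> carrier R"
  shows "v \<in> poly_values K t n \<Longrightarrow> w \<in> poly_values K t n \<Longrightarrow> v \<oplus> w \<in> poly_values K t n"
proof (induction n arbitrary: v w)
  case (Suc n)
  obtain v' r where v: "v = v' \<otimes> t \<oplus> r" "v' \<in> poly_values K t n" "r \<in> K" using Suc.prems by auto
  obtain w' s where w: "w = w' \<otimes> t \<oplus> s" "w' \<in> poly_values K t n" "s \<in> K" using Suc.prems by auto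
  note K = subringE(1)[OF assms(1)]
  have c: "v' \<in> carrier R" "w' \<in> carrier R" "r \<in> carrier R" "s \<in> carrier R"
    using poly_values_closed[OF K assms(2)] v w K by blast+
  have "v \<oplus> w = (v' \<oplus> w') \<otimes> t \<oplus> (r \<oplus> s)"
    unfolding v(1) w(1) using c assms(2) by algebra
  then show ?case
    using poly_values_SucI[OF Suc.IH[OF v(2) w(2)] subringE(7)[OF assms(1) v(3) w(3)]] by simp
qed (use assms in auto)

lemma poly_values_smult:
  assumes "subring K R" "t \<in> carrier R" "a \<in> K"
  shows "w \<in> poly_values K t n \<Longrightarrow> a \<otimes> w \<in> poly_values K t n"
proof (induction n arbitrary: w)
  case 0
  then show ?case using subsetD[OF subringE(1)[OF assms(1)] assms(3)] by simp
next
  case (Suc n)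
  obtain w' s where w: "w = w' \<otimes> t \<oplus> s" "w' \<in> poly_values K t n" "s \<in> K" using Suc.prems by auto
  note K = subringE(1)[OF assms(1)]
  have c: "w' \<in> carrier R" "a \<in> carrier R" "s \<in> carrier R"
    using poly_values_closed[OF K assms(2)] w assms(3) K by blast+
  have "a \<otimes> w = (a \<otimes> w') \<otimes> t \<oplus> (a \<otimes> s)"
    unfolding w(1) using c assms(2) by algebra
  then show ?case
    using poly_values_SucI[OF Suc.IH[OF w(2)] subringE(6)[OF assms(1,3) w(3)]] by simp
qed

lemma poly_values_shift:
  assumes "subring K R" "t \<in> carrier R" "w \<in> poly_values K t n"
  shows "w \<otimes> t \<in> poly_values K t (Suc n)"
  using poly_values_SucI[OF assms(3) subringE(2)[OF assms(1)]]
    poly_values_closed[OF subringE(1)[OF assms(1)] assms(2,3)] assms(2) by simp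

lemma poly_values_shift_pow:
  assumes "subring K R" "t \<in> carrier R" "w \<in> poly_values K t n"
  shows "w \<otimes> t [^] (j::nat) \<in> poly_values K t (n + j)"
proof (induction j)
  case 0
  then show ?case using assms(3) poly_values_closed[OF subringE(1)[OF assms(1)] assms(2,3)] by simp
next
  case (Suc j)
  have "w \<in> carrier R" using poly_values_closed[OF subringE(1)[OF assms(1)] assms(2,3)] .
  then have "w \<otimes> t [^] Suc j = (w \<otimes> t [^] j) \<otimes> t" using assms(2) by (simp add: m_assoc)
  then show ?case using poly_values_shift[OF assms(1,2) Suc.IH] by simp
qed

text \<open>The recursion of \<open>poly_values\<close> exposes the constant coefficient; induction
  trades it for the leading one, so that degrees can also be lowered from the top.\<close>

lemma poly_values_top:
  assumes "subring K R" "t \<in> carrier R" "w \<in> poly_values K t (Suc n)"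
  shows "\<exists>v\<in>poly_values K t n. \<exists>r\<in>K. w = v \<oplus> r \<otimes> t [^] n"
  using assms(3)
proof (induction n arbitrary: w)
  case 0
  then obtain r where r: "r \<in> K" "w = \<zero> \<otimes> t \<oplus> r" by auto
  then have "w = \<zero> \<oplus> r \<otimes> t [^] (0::nat)"
    using subsetD[OF subringE(1)[OF assms(1)] r(1)] assms(2) by simp
  then show ?case using r(1) by auto
next
  case (Suc n)
  obtain w' s where w: "w = w' \<otimes> t \<oplus> s" "w' \<in> poly_values K t (Suc n)" "s \<in> K"
    using Suc.prems by auto
  obtain v r where v: "v \<in> poly_values K t n" "r \<in> K" "w' = v \<oplus> r \<otimes> t [^] n"
    using Suc.IH[OF w(2)] by blast
  note K = subringE(1)[OF assms(1)]
  have c: "v \<in> carrier R" "r \<in> carrier R" "s \<in> carrier R" "t [^] n \<in> carrier R"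
    using poly_values_closed[OF K assms(2)] v w assms K by auto
  have "w = (v \<otimes> t \<oplus> s) \<oplus> r \<otimes> t [^] Suc n"
    unfolding w(1) v(3) nat_pow_Suc using c assms(2) by algebra
  then show ?case using poly_values_SucI[OF v(1) w(3)] v(2) by blast
qed

text \<open>Both sides arise from zero by Horner steps; \<open>poly_values\<close> counts the steps,
  which makes arguments by least degree possible.\<close>

lemma simple_extension_eq_poly_values:
  "simple_extension K t = (\<Union>n. poly_values K t n)"
proof
  show "simple_extension K t \<subseteq> (\<Union>n. poly_values K t n)"
  proof
    fix a assume "a \<in> simple_extension K t"
    then show "a \<in> (\<Union>n. poly_values K t n)"
    proof induction
      case zero
      show ?case by (rule UN_I[of 0]) auto
    next
      case (lin k1 k2)
      then obtain n where "k1 \<in> poly_values K t n" by blast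
      then show ?case using lin by (intro UN_I[of "Suc n"]) auto
    qed
  qed
  have "w \<in> poly_values K t n \<Longrightarrow> w \<in> simple_extension K t" for w n
    by (induction n arbitrary: w) (auto intro: simple_extension.lin)
  then show "(\<Union>n. poly_values K t n) \<subseteq> simple_extension K t" by blast
qed

text \<open>Homogenization: for \<open>i < k\<close>, multiplying \<open>c t^i\<close> by
  \<open>x^(m(k-1))\<close> gives an element of \<open>K\<close> times \<open>(x^m t)^i\<close>. A
  further factor \<open>x^m\<close> on both sides avoids the exponent \<open>k - 1\<close>.\<close>

lemma poly_values_scale:
  assumes "subring K R" "t \<in> carrier R" "x \<in> K"
  shows "w \<in> poly_values K t k \<Longrightarrow>
    \<exists>v\<in>poly_values K (x [^] (m::nat) \<otimes> t) k. x [^] (m * k) \<otimes> w = x [^] m \<otimes> v"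
proof (induction k arbitrary: w)
  case 0
  then show ?case using subsetD[OF subringE(1)[OF assms(1)] assms(3)] assms(2) by simp
next
  case (Suc k)
  note K = subringE(1)[OF assms(1)]
  obtain w' s where w: "w = w' \<otimes> t \<oplus> s" "w' \<in> poly_values K t k" "s \<in> K"
    using Suc.prems by auto
  obtain v where v: "v \<in> poly_values K (x [^] m \<otimes> t) k" "x [^] (m * k) \<otimes> w' = x [^] m \<otimes> v"
    using Suc.IH[OF w(2)] by blast
  have x: "x \<in> carrier R" using assms K by blast
  have pK: "x [^] j \<in> K" for j :: nat
    by (induction j) (simp_all add: subringE(3,6)[OF assms(1)] assms(3))
  have c: "w' \<in> carrier R" "s \<in> carrier R" "x [^] m \<in> carrier R" "x [^] (m * k) \<in> carrier R"
    using poly_values_closed[OF K assms(2)] w assms K by auto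
  have cv: "v \<in> carrier R" using poly_values_closed[OF K _ v(1)] c assms(2) by auto
  have "x [^] (m * Suc k) \<otimes> w = x [^] m \<otimes> ((x [^] (m * k) \<otimes> w') \<otimes> t \<oplus> x [^] (m * k) \<otimes> s)"
    unfolding w(1) mult_Suc_right nat_pow_mult[OF x, symmetric] using c assms(2) by algebra
  also have "\<dots> = x [^] m \<otimes> (v \<otimes> (x [^] m \<otimes> t) \<oplus> x [^] (m * k) \<otimes> s)"
    unfolding v(2) using c cv assms(2) by algebra
  finally show ?case
    using poly_values_SucI[OF v(1) subringE(6)[OF assms(1) pK w(3)]] by blast
qed

end

section \<open>Rings with a unit that is a prime element of a subring\<close>

context domain
begin

text \<open>
  \<open>E\<close> plays the role of the elements that are units modulo \<open>x\<close>. Taking both relations of minimal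
  degree, each one can be used to lower the degree of the other.
\<close>

lemma chevalley_no_two_relations:
  assumes S: "subring S R" and t: "t \<in> carrier R" "t \<noteq> \<zero>"
    and x: "x \<in> S" "x \<in> Units R"
    and E: "E \<subseteq> S"
    and E_mult: "\<And>e e'. e \<in> E \<Longrightarrow> e' \<in> E \<Longrightarrow> e \<otimes> e' \<in> E"
    and E_minus: "\<And>e r. e \<in> E \<Longrightarrow> r \<in> S \<Longrightarrow> e \<ominus> x \<otimes> r \<in> E"
    and E_inv: "\<And>e. e \<in> E \<Longrightarrow> inv x \<otimes> e \<notin> S"
    and I: "\<exists>n. \<exists>e\<in>E. \<exists>w\<in>poly_values S t n. inv x \<otimes> e = w \<otimes> t"
    and II: "\<exists>k. \<exists>e\<in>E. inv x \<otimes> e \<otimes> t [^] (k::nat) \<in> poly_values S t k"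
  shows False
proof -
  note Sc = subringE(1)[OF S]
  define y where "y = inv x"
  have xc: "x \<in> carrier R" "y \<in> carrier R" "x \<otimes> y = \<one>" "y \<otimes> x = \<one>"
    using x unfolding y_def by auto
  have Wc: "w \<in> carrier R" if "w \<in> poly_values S t n" for w n
    using poly_values_closed[OF Sc t(1) that] .
  have Ec: "e \<in> carrier R" "e \<in> S" if "e \<in> E" for e using that E Sc by auto
  \<comment> \<open>\<open>?I n\<close> writes \<open>e/x\<close> as a polynomial in
    \<open>t\<close> of degree at most \<open>n\<close> without constant term. \<open>?II k\<close>
    does the same with a polynomial in \<open>1/t\<close> of degree at most \<open>k\<close>,
    cleared of denominators by \<open>t^k\<close>.\<close>
  let ?I = "\<lambda>n. \<exists>e\<in>E. \<exists>w\<in>poly_values S t n. y \<otimes> e = w \<otimes> t"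
  let ?II = "\<lambda>k. \<exists>e\<in>E. y \<otimes> e \<otimes> t [^] (k::nat) \<in> poly_values S t k"
  have exI: "\<exists>n. ?I n" and exII: "\<exists>k. ?II k" using I II unfolding y_def by auto
  define n where "n = (LEAST n. ?I n)"
  define k where "k = (LEAST k. ?II k)"
  have n: "?I n" "\<And>m. m < n \<Longrightarrow> \<not> ?I m"
    unfolding n_def using LeastI_ex[OF exI] not_less_Least[of _ ?I] by blast+
  have k: "?II k" "\<And>m. m < k \<Longrightarrow> \<not> ?II m"
    unfolding k_def using LeastI_ex[OF exII] not_less_Least[of _ ?II] by blast+
  obtain e1 w1 where e1: "e1 \<in> E" "w1 \<in> poly_values S t n" "y \<otimes> e1 = w1 \<otimes> t" using n(1) by blast
  obtain e where e: "e \<in> E" "y \<otimes> e \<otimes> t [^] k \<in> poly_values S t k" using k(1) by blast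
  have "n \<noteq> 0"
  proof
    assume "n = 0"
    then have "y \<otimes> e1 = \<zero>" using e1 t by simp
    then show False using E_inv[OF e1(1)] subringE(2)[OF S] unfolding y_def by simp
  qed
  then obtain n' where n': "n = Suc n'" by (cases n) auto
  have "k \<noteq> 0"
  proof
    assume "k = 0"
    then have "y \<otimes> e = \<zero>" using e Ec(1)[OF e(1)] xc by simp
    then show False using E_inv[OF e(1)] subringE(2)[OF S] unfolding y_def by simp
  qed
  then obtain k' where k': "k = Suc k'" by (cases k) auto
  define w2 where "w2 = y \<otimes> e \<otimes> t [^] k"
  have w2: "w2 \<in> poly_values S t k" "w2 \<in> carrier R" using e Wc unfolding w2_def by auto
  have c: "e \<in> carrier R" "e1 \<in> carrier R" "w1 \<in> carrier R" using Ec e e1 Wc by auto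
  show False
  proof (cases "k \<le> n")
    case True
    \<comment> \<open>Relation I is multiplied by \<open>e\<close>. Its top term
      \<open>e r t^n\<close> becomes \<open>x r w2 t^(n-k)\<close> by relation II and so drops below
      degree \<open>n\<close>. The constant term \<open>r0\<close> of the result is absorbed by
      passing from \<open>e e1\<close> to \<open>e e1 - x r0\<close>, which leaves a relation I of
      degree \<open>n'\<close>.\<close>
    obtain v r where v: "v \<in> poly_values S t n'" "r \<in> S" "w1 = v \<oplus> r \<otimes> t [^] n'"
      using poly_values_top[OF S t(1)] e1(2) n' by blast
    have cc: "v \<in> carrier R" "r \<in> carrier R" using v Wc Sc by auto
    define q where "q = e \<otimes> v \<otimes> t \<oplus> (x \<otimes> r) \<otimes> (w2 \<otimes> t [^] (n - k))"
    have tn: "t [^] n' \<otimes> t = t [^] k \<otimes> t [^] (n - k)"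
      using nat_pow_mult[OF t(1), of k "n-k"] True n' by simp
    have "e \<otimes> v \<otimes> t \<in> poly_values S t n"
      using poly_values_shift[OF S t(1) poly_values_smult[OF S t(1) Ec(2)[OF e(1)] v(1)]] n' by simp
    moreover have "w2 \<otimes> t [^] (n - k) \<in> poly_values S t n"
      using poly_values_shift_pow[OF S t(1) w2(1), of "n - k"] True by simp
    then have "(x \<otimes> r) \<otimes> (w2 \<otimes> t [^] (n - k)) \<in> poly_values S t n"
      using poly_values_smult[OF S t(1) subringE(6)[OF S x(1) v(2)]] by blast
    ultimately have q: "q \<in> poly_values S t (Suc n')"
      unfolding q_def using poly_values_add[OF S t(1)] n' by blast
    then obtain q' r0 where q': "q' \<in> poly_values S t n'" "r0 \<in> S" "q = q' \<otimes> t \<oplus> r0" by auto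
    have cq: "q' \<in> carrier R" "r0 \<in> carrier R" using q' Wc Sc by auto
    have ct: "t [^] n' \<in> carrier R" "t [^] k \<in> carrier R" "t [^] (n - k) \<in> carrier R" using t by auto
    have "y \<otimes> (e \<otimes> e1) = e \<otimes> (w1 \<otimes> t)"
      unfolding e1(3)[symmetric] using c xc by (simp add: m_ac)
    also have "\<dots> = e \<otimes> v \<otimes> t \<oplus> e \<otimes> r \<otimes> (t [^] n' \<otimes> t)"
      unfolding v(3) using c cc ct t(1) by (simp add: m_ac l_distr r_distr)
    also have "e \<otimes> r \<otimes> (t [^] n' \<otimes> t) = (x \<otimes> y) \<otimes> (e \<otimes> r \<otimes> (t [^] k \<otimes> t [^] (n - k)))"
      unfolding tn xc(3) using c cc ct by simp
    also have "\<dots> = (x \<otimes> r) \<otimes> (w2 \<otimes> t [^] (n - k))"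
      unfolding w2_def using c cc ct xc(1,2) by (simp add: m_ac)
    finally have yee: "y \<otimes> (e \<otimes> e1) = q" unfolding q_def .
    have "y \<otimes> (e \<otimes> e1 \<ominus> x \<otimes> r0) = y \<otimes> (e \<otimes> e1) \<ominus> (y \<otimes> x) \<otimes> r0"
      using c cq xc(1,2) by algebra
    also have "\<dots> = q' \<otimes> t"
      unfolding yee xc(4) q'(3) using cq t(1) by algebra
    finally have "?I n'"
      using E_minus[OF E_mult[OF e(1) e1(1)] q'(2)] q'(1) by blast
    then show False using n(2)[of n'] n' by simp
  next
    case False
    then have le: "n \<le> k'" using k' by simp
    \<comment> \<open>Relation II is multiplied by \<open>e1\<close>. In the constant term
      \<open>b0 e1\<close>, relation I replaces \<open>e1\<close> by \<open>x w1 t\<close>, so the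
      right-hand side becomes divisible by \<open>t\<close>; cancelling \<open>t\<close> leaves a
      relation II for \<open>k'\<close>.\<close>
    obtain v b0 where v: "v \<in> poly_values S t k'" "b0 \<in> S" "w2 = v \<otimes> t \<oplus> b0"
      using w2(1) k' by auto
    have cc: "v \<in> carrier R" "b0 \<in> carrier R" using v Wc Sc by auto
    have ct: "t [^] k' \<in> carrier R" "t [^] k \<in> carrier R" using t by auto
    define q where "q = e1 \<otimes> v \<oplus> (x \<otimes> b0) \<otimes> w1"
    have q: "q \<in> poly_values S t k'"
      unfolding q_def
      using poly_values_add[OF S t(1) poly_values_smult[OF S t(1) Ec(2)[OF e1(1)] v(1)]
          poly_values_smult[OF S t(1) subringE(6)[OF S x(1) v(2)] poly_values_mono[OF S t(1) le e1(2)]]] .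
    have "(y \<otimes> (e \<otimes> e1) \<otimes> t [^] k') \<otimes> t = e1 \<otimes> w2"
      unfolding w2_def k' using c ct xc(2) t(1) by (simp add: m_ac)
    also have "\<dots> = e1 \<otimes> v \<otimes> t \<oplus> b0 \<otimes> (x \<otimes> y \<otimes> e1)"
      unfolding v(3) xc(3) using c cc t(1) by algebra
    also have "\<dots> = e1 \<otimes> v \<otimes> t \<oplus> b0 \<otimes> (x \<otimes> (y \<otimes> e1))"
      using c cc xc(1,2) by (simp add: m_assoc)
    also have "\<dots> = q \<otimes> t"
      unfolding q_def e1(3) using c cc t(1) xc(1,2) by algebra
    finally have "(y \<otimes> (e \<otimes> e1) \<otimes> t [^] k') \<otimes> t = q \<otimes> t" .
    then have "y \<otimes> (e \<otimes> e1) \<otimes> t [^] k' = q"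
      using m_rcancel[OF t(2) t(1)] c ct xc(2) Wc[OF q] by auto
    then have "?II k'" using E_mult[OF e(1) e1(1)] q by blast
    then show False using k(2)[of k'] k' by simp
  qed
qed

lemma poly_values_subset:
  assumes "K \<subseteq> K'"
  shows "poly_values K t n \<subseteq> poly_values K' t n"
  by (induction n) (use assms in auto)

text \<open>Take a subring over \<open>S\<close> maximal among those avoiding \<open>1/x\<close>.
  Anything strictly larger contains \<open>1/x\<close>, hence every \<open>t\<close>, since
  \<open>t\<close> is a power of \<open>1/x\<close> times an element of \<open>S\<close>.\<close>

lemma maximal_subring_of_unit:
  assumes S: "subring S R" and x: "x \<in> Units R" and "inv x \<notin> S"
    and arch: "\<And>t. t \<in> carrier R \<Longrightarrow> \<exists>n. x [^] (n::nat) \<otimes> t \<in> S"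
  shows "\<exists>M. maximal_subring M R"
proof -
  obtain M where M: "subring M R" "S \<subseteq> M" "inv x \<notin> M"
    "\<And>S'. subring S' R \<Longrightarrow> M \<subseteq> S' \<Longrightarrow> inv x \<notin> S' \<Longrightarrow> S' = M"
    by (rule subring_maximal_exists[OF S, of "\<lambda>S. inv x \<notin> S"]) (use assms(3) in \<open>simp, blast, blast\<close>)
  have xc: "x \<in> carrier R" "inv x \<in> carrier R" using x by auto
  have "S' = M" if S': "subring S' R" "M \<subseteq> S'" "S' \<noteq> carrier R" for S'
  proof (rule M(4)[OF S'(1,2)])
    show "inv x \<notin> S'"
    proof
      assume inv: "inv x \<in> S'"
      then have pow: "inv x [^] (n::nat) \<in> S'" for n
        by (induction n) (simp_all add: subringE(3,6)[OF S'(1)])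
      have "t \<in> S'" if t: "t \<in> carrier R" for t
      proof -
        obtain n :: nat where "x [^] n \<otimes> t \<in> S" using arch t by blast
        then have "inv x [^] n \<otimes> (x [^] n \<otimes> t) \<in> S'"
          using subringE(6)[OF S'(1) pow, of "x [^] n \<otimes> t" n] M(2) S'(2) by blast
        moreover have "inv x [^] n \<otimes> x [^] n = \<one>"
          using pow_mult_distrib[of "inv x" x n] xc x by (simp add: m_comm)
        ultimately show ?thesis using t xc by (simp add: m_assoc[symmetric])
      qed
      then show False using S'(3) subringE(1)[OF S'(1)] by blast
    qed
  qed
  moreover have "M \<noteq> carrier R" using M(3) xc by blast
  ultimately show ?thesis using M(1) unfolding maximal_subring_def by blast
qed

text \<open>Chevalley's argument. \<open>S\<close> is taken maximal such that no element of
  \<open>F\<close> becomes newly divisible by \<open>x\<close>. An element outside \<open>S\<close>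
  then satisfies a relation in its positive powers. Algebraicity over \<open>F\<close> gives, after
  scaling by a power of \<open>x\<close>, a relation in negative powers, and the two are
  incompatible. Hence a power of \<open>x\<close> carries each element into
  \<open>S\<close>.\<close>

theorem maximal_subring_of_prime_unit:
  assumes F: "subring F R" and x: "x \<in> F" "x \<in> Units R"
    and inv_notin: "inv x \<notin> F"
    and prime: "\<And>f g. f \<in> F \<Longrightarrow> g \<in> F \<Longrightarrow> inv x \<otimes> (f \<otimes> g) \<in> F \<Longrightarrow>
                  inv x \<otimes> f \<in> F \<or> inv x \<otimes> g \<in> F"
    and sep: "\<And>f. f \<in> F \<Longrightarrow> (\<And>n::nat. inv x [^] n \<otimes> f \<in> F) \<Longrightarrow> f = \<zero>"
    and alg: "\<And>t. t \<in> carrier R \<Longrightarrow> \<exists>k. \<exists>a\<in>F - {\<zero>}. a \<otimes> t [^] (k::nat) \<in> poly_values F t k"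
  shows "\<exists>M. maximal_subring M R"
proof -
  define y where "y = inv x"
  have xc: "x \<in> carrier R" "y \<in> carrier R" "x \<otimes> y = \<one>" "y \<otimes> x = \<one>"
    using x unfolding y_def by auto
  note Fc = subringE(1)[OF F]
  obtain S where S: "subring S R" "F \<subseteq> S"
    and SF: "\<And>f. f \<in> F \<Longrightarrow> y \<otimes> f \<in> S \<Longrightarrow> y \<otimes> f \<in> F"
    and Smax: "\<And>S'. subring S' R \<Longrightarrow> S \<subseteq> S' \<Longrightarrow> \<forall>f\<in>F. y \<otimes> f \<in> S' \<longrightarrow> y \<otimes> f \<in> F \<Longrightarrow> S' = S"
    by (rule subring_maximal_exists[OF F, of "\<lambda>S. \<forall>f\<in>F. y \<otimes> f \<in> S \<longrightarrow> y \<otimes> f \<in> F"]) (simp, blast, blast)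
  note Sc = subringE(1)[OF S(1)]
  note Scl = subringE(5,6,7)[OF S(1)] subsetD[OF S(2)]
  \<comment> \<open>\<open>E\<close> collects the elements of \<open>S\<close> that are congruent
    modulo \<open>xS\<close> to an element of \<open>F\<close> outside \<open>xF\<close>. It is
    multiplicative because \<open>x\<close> is prime in \<open>F\<close>, and disjoint from
    \<open>xS\<close> by the choice of \<open>S\<close>.\<close>
  define E where "E = {e \<in> S. \<exists>f\<in>F. y \<otimes> f \<notin> F \<and> y \<otimes> (f \<ominus> e) \<in> S}"
  have ES: "E \<subseteq> S" unfolding E_def by blast
  have E_mult: "e \<otimes> e' \<in> E" if e: "e \<in> E" "e' \<in> E" for e e'
  proof -
    obtain f where f: "f \<in> F" "y \<otimes> f \<notin> F" "y \<otimes> (f \<ominus> e) \<in> S" "e \<in> S" using e unfolding E_def by auto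
    obtain f' where f': "f' \<in> F" "y \<otimes> f' \<notin> F" "y \<otimes> (f' \<ominus> e') \<in> S" "e' \<in> S"
      using e unfolding E_def by auto
    have c: "f \<in> carrier R" "f' \<in> carrier R" "e \<in> carrier R" "e' \<in> carrier R" using f f' Fc Sc by auto
    have "y \<otimes> (f \<otimes> f' \<ominus> e \<otimes> e') = (y \<otimes> (f \<ominus> e)) \<otimes> f' \<oplus> e \<otimes> (y \<otimes> (f' \<ominus> e'))"
      using c xc(2) by algebra
    also have "\<dots> \<in> S" using f f' by (simp add: Scl)
    finally have "y \<otimes> (f \<otimes> f' \<ominus> e \<otimes> e') \<in> S" .
    moreover have "y \<otimes> (f \<otimes> f') \<notin> F" using prime[OF f(1) f'(1)] f(2) f'(2) unfolding y_def by blast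
    ultimately show ?thesis
      unfolding E_def using subringE(6)[OF S(1) f(4) f'(4)] subringE(6)[OF F f(1) f'(1)] by blast
  qed
  have E_minus: "e \<ominus> x \<otimes> r \<in> E" if e: "e \<in> E" and r: "r \<in> S" for e r
  proof -
    obtain f where f: "f \<in> F" "y \<otimes> f \<notin> F" "y \<otimes> (f \<ominus> e) \<in> S" "e \<in> S" using e unfolding E_def by auto
    have c: "f \<in> carrier R" "r \<in> carrier R" "e \<in> carrier R" using f r Fc Sc by auto
    have "y \<otimes> (f \<ominus> (e \<ominus> x \<otimes> r)) = y \<otimes> (f \<ominus> e) \<oplus> (y \<otimes> x) \<otimes> r"
      using c xc(1,2) by algebra
    also have "\<dots> \<in> S" unfolding xc(4) using f(3) r c by (simp add: Scl)
    finally have "y \<otimes> (f \<ominus> (e \<ominus> x \<otimes> r)) \<in> S" .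
    moreover have "e \<ominus> x \<otimes> r \<in> S"
      unfolding a_minus_def using f(4) r x(1) by (simp add: Scl)
    ultimately show ?thesis unfolding E_def using f by blast
  qed
  have E_inv: "y \<otimes> e \<notin> S" if e: "e \<in> E" for e
  proof
    assume ye: "y \<otimes> e \<in> S"
    obtain f where f: "f \<in> F" "y \<otimes> f \<notin> F" "y \<otimes> (f \<ominus> e) \<in> S" "e \<in> S" using e unfolding E_def by auto
    have c: "f \<in> carrier R" "e \<in> carrier R" using f Fc Sc by auto
    have "y \<otimes> f = y \<otimes> (f \<ominus> e) \<oplus> y \<otimes> e" using c xc(2) by algebra
    then have "y \<otimes> f \<in> S" using f(3) ye by (simp add: Scl)
    then show False using SF f by blast
  qed
  \<comment> \<open>Since \<open>t\<close> is not in \<open>S\<close>, passing to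
    \<open>S[t]\<close> must violate the condition defining \<open>S\<close>: some
    \<open>f/x\<close> outside \<open>F\<close> is a polynomial in \<open>t\<close>. Moving its
    constant term \<open>r\<close> to the other side replaces \<open>f\<close> by
    \<open>f - xr\<close>, an element of \<open>E\<close>.\<close>
  have relI: "\<exists>n. \<exists>e\<in>E. \<exists>w\<in>poly_values S t n. y \<otimes> e = w \<otimes> t"
    if t: "t \<in> carrier R" "t \<notin> S" for t
  proof -
    have "simple_extension S t \<noteq> S" using simple_extension_mem[OF S(1) t(1)] t(2) by blast
    then obtain f where f: "f \<in> F" "y \<otimes> f \<in> simple_extension S t" "y \<otimes> f \<notin> F"
      using Smax[OF simple_extension_is_subring[OF S(1) t(1)] simple_extension_incl[OF Sc t(1)]] by blast
    then obtain m where m: "y \<otimes> f \<in> poly_values S t m" unfolding simple_extension_eq_poly_values by blast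
    have "m \<noteq> 0" using m f(3) subringE(2)[OF F] by (intro notI) simp
    then obtain w r where w: "w \<in> poly_values S t (m - 1)" "r \<in> S" "y \<otimes> f = w \<otimes> t \<oplus> r"
      using m by (cases m) auto
    have c: "f \<in> carrier R" "r \<in> carrier R" "w \<in> carrier R"
      using f w Fc Sc poly_values_closed[OF Sc t(1) w(1)] by auto
    have "y \<otimes> (f \<ominus> (f \<ominus> x \<otimes> r)) = (y \<otimes> x) \<otimes> r" using c xc(1,2) by algebra
    then have "y \<otimes> (f \<ominus> (f \<ominus> x \<otimes> r)) \<in> S" using xc w c by simp
    moreover have "f \<ominus> x \<otimes> r \<in> S"
      unfolding a_minus_def using f(1) w(2) x(1) by (simp add: Scl)
    ultimately have "f \<ominus> x \<otimes> r \<in> E" unfolding E_def using f by blast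
    moreover have "y \<otimes> (f \<ominus> x \<otimes> r) = y \<otimes> f \<ominus> (y \<otimes> x) \<otimes> r" using c xc(1,2) by algebra
    then have "y \<otimes> (f \<ominus> x \<otimes> r) = w \<otimes> t"
      unfolding xc(4) w(3) using c t(1) by (simp add: a_minus_def a_assoc r_neg)
    ultimately show ?thesis using w(1) by blast
  qed
  have arch: "\<exists>n. x [^] (n::nat) \<otimes> t \<in> S" if t: "t \<in> carrier R" for t
  proof -
    obtain k a where a: "a \<in> F" "a \<noteq> \<zero>" "a \<otimes> t [^] (k::nat) \<in> poly_values F t k" using alg t by blast
    have ac: "a \<in> carrier R" using a Fc by blast
    have ex: "\<exists>n::nat. y [^] n \<otimes> a \<notin> F" using sep a unfolding y_def by blast
    \<comment> \<open>\<open>x^n\<close> is the first power of \<open>x\<close> that does not divide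
      \<open>a\<close> in \<open>F\<close>, so \<open>s = a/x^(n-1)\<close> lies in \<open>F\<close>
      but not in \<open>xF\<close>, and therefore in \<open>E\<close>.\<close>
    define n where "n = (LEAST n::nat. y [^] n \<otimes> a \<notin> F)"
    have n: "y [^] n \<otimes> a \<notin> F" "\<And>m. m < n \<Longrightarrow> y [^] m \<otimes> a \<in> F"
      unfolding n_def using LeastI_ex[OF ex] not_less_Least[of _ "\<lambda>n. y [^] n \<otimes> a \<notin> F"] by blast+
    have "n \<noteq> 0" using n(1) a(1) ac by (intro notI) simp
    then obtain m where m: "n = Suc m" by (cases n) auto
    define s where "s = y [^] m \<otimes> a"
    have s: "s \<in> F" "s \<in> carrier R" using n(2)[of m] m Fc unfolding s_def by auto
    have ys: "y \<otimes> s \<notin> F"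
      using n(1) xc(2) ac unfolding m s_def by (simp add: m_ac)
    have "s \<in> E"
    proof -
      have "y \<otimes> (s \<ominus> s) = \<zero>" using s xc(2) by algebra
      then show ?thesis unfolding E_def using s ys S(2) subringE(2)[OF S(1)] by auto
    qed
    \<comment> \<open>Scaling by \<open>x^n\<close> turns the equation of \<open>t\<close> with
      leading coefficient \<open>a\<close> into one of \<open>z\<close> with leading coefficient
      \<open>s/x\<close>, a relation of the second kind.\<close>
    define z where "z = x [^] n \<otimes> t"
    have xp: "x [^] j \<in> carrier R" "t [^] j \<in> carrier R" for j :: nat using xc t by auto
    have zc: "z \<in> carrier R" unfolding z_def using xp t by simp
    obtain v where v: "v \<in> poly_values F z k" "x [^] (n * k) \<otimes> (a \<otimes> t [^] k) = x [^] n \<otimes> v"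
      using poly_values_scale[OF F t x(1) a(3), of n] unfolding z_def by blast
    have vc: "v \<in> carrier R" using poly_values_closed[OF Fc zc v(1)] .
    have yx: "y [^] j \<otimes> x [^] j = \<one>" for j :: nat
      using pow_mult_distrib[of y x j] xc by (simp add: m_comm)
    have zk: "z [^] k = x [^] (n * k) \<otimes> t [^] k"
      unfolding z_def using nat_pow_distrib[OF xp(1) t, of n k] nat_pow_pow[OF xc(1), of n k] by simp
    have yp: "y [^] j \<in> carrier R" for j :: nat using xc by auto
    have "y \<otimes> s \<otimes> z [^] k = y [^] n \<otimes> (x [^] (n * k) \<otimes> (a \<otimes> t [^] k))"
      unfolding zk s_def m using xp yp xc(2) ac by (simp add: m_ac)
    also have "\<dots> = (y [^] n \<otimes> x [^] n) \<otimes> v"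
      unfolding v(2) using xp yp vc by (simp add: m_assoc)
    also have "\<dots> = v" unfolding yx using vc by simp
    finally have "y \<otimes> s \<otimes> z [^] k \<in> poly_values S z k"
      using v(1) poly_values_subset[OF S(2)] by auto
    then have II: "\<exists>k. \<exists>e\<in>E. inv x \<otimes> e \<otimes> z [^] (k::nat) \<in> poly_values S z k"
      using \<open>s \<in> E\<close> unfolding y_def by blast
    have "z \<in> S"
    proof (rule ccontr)
      assume z: "z \<notin> S"
      then have "z \<noteq> \<zero>" using subringE(2)[OF S(1)] by blast
      then show False
        using chevalley_no_two_relations[OF S(1) zc _ subsetD[OF S(2) x(1)] x(2) ES E_mult E_minus
            E_inv[unfolded y_def] relI[OF zc z, unfolded y_def] II] by blast
    qed
    then show ?thesis unfolding z_def by blast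
  qed
  have "inv x \<notin> S"
  proof
    assume "inv x \<in> S"
    then have "y \<otimes> \<one> \<in> F" using SF[of \<one>] subringE(3)[OF F] xc unfolding y_def by simp
    then show False using inv_notin xc unfolding y_def by simp
  qed
  then show ?thesis using maximal_subring_of_unit[OF S(1) x(2) _ arch] by blast
qed

end

section \<open>Transcendental units\<close>

text \<open>For \<open>x \<noteq> \<zero>\<close> this is transcendence of \<open>x\<close> over \<open>K\<close>; beware that \<open>\<zero>\<close> also satisfies it.\<close>

definition (in ring) free_over :: "'a set \<Rightarrow> 'a \<Rightarrow> bool" where
  "free_over K x \<longleftrightarrow> (\<forall>f\<in>simple_extension K x. \<forall>c\<in>K. f \<otimes> x \<oplus> c = \<zero> \<longrightarrow> c = \<zero>)"

context ring
begin

lemma free_overD: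
  "free_over K x \<Longrightarrow> f \<in> simple_extension K x \<Longrightarrow> c \<in> K \<Longrightarrow> f \<otimes> x \<oplus> c = \<zero> \<Longrightarrow> c = \<zero>"
  unfolding free_over_def by blast

lemma simple_extensionE:
  assumes "subring K R" "x \<in> carrier R" "f \<in> simple_extension K x"
  obtains f' c where "f' \<in> simple_extension K x" "c \<in> K" "f = f' \<otimes> x \<oplus> c"
  using assms(3)
proof cases
  case zero
  then show ?thesis
    using that[of \<zero> \<zero>] subringE(2)[OF assms(1)] simple_extension.zero assms(2) by simp
next
  case (lin k1 k2)
  then show ?thesis using that by blast
qed

end

context domain
begin

text \<open>Failure of \<open>free_over\<close> gives a relation with nonzero constant coefficient.
  In one of least degree the leading coefficient is nonzero too, since otherwise the top term could
  be dropped. The element \<open>\<zero>\<close> satisfies \<open>free_over\<close> and is treated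
  apart.\<close>

lemma algebraic_leading_coeff:
  assumes K: "subring K R" and t: "t \<in> carrier R" and nf: "t = \<zero> \<or> \<not> free_over K t"
  shows "\<exists>k. \<exists>a\<in>K - {\<zero>}. a \<otimes> t [^] (k::nat) \<in> poly_values K t k"
proof (cases "t = \<zero>")
  case True
  have "\<one> \<otimes> t [^] (1::nat) = \<zero> \<otimes> t \<oplus> \<zero>" using True by simp
  moreover have "\<zero> \<otimes> t \<oplus> \<zero> \<in> poly_values K t 1"
    using poly_values_SucI[of \<zero> K t 0 \<zero>] subringE(2)[OF K] by simp
  ultimately show ?thesis using subringE(3)[OF K] one_not_zero by (metis DiffI singletonD)
next
  case False
  note Kc = subringE(1)[OF K]
  let ?P = "\<lambda>k. \<exists>f\<in>poly_values K t k. \<exists>c\<in>K. f \<otimes> t \<oplus> c = \<zero> \<and> c \<noteq> \<zero>"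
  have ex: "\<exists>k. ?P k"
    using nf False unfolding free_over_def simple_extension_eq_poly_values by blast
  define k where "k = (LEAST k. ?P k)"
  have k: "?P k" "\<And>m. m < k \<Longrightarrow> \<not> ?P m"
    unfolding k_def using LeastI_ex[OF ex] not_less_Least[of _ ?P] by blast+
  obtain f c where f: "f \<in> poly_values K t k" "c \<in> K" "f \<otimes> t \<oplus> c = \<zero>" "c \<noteq> \<zero>" using k(1) by blast
  have cc: "c \<in> carrier R" using f Kc by blast
  have "k \<noteq> 0"
  proof
    assume "k = 0"
    then have "f = \<zero>" using f(1) by simp
    then show False using f(3,4) cc t by simp
  qed
  then obtain m where m: "k = Suc m" by (cases k) auto
  obtain v r where v: "v \<in> poly_values K t m" "r \<in> K" "f = v \<oplus> r \<otimes> t [^] m"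
    using poly_values_top[OF K t] f(1) m by blast
  have vc: "v \<in> carrier R" "r \<in> carrier R" "t [^] m \<in> carrier R"
    using v poly_values_closed[OF Kc t v(1)] Kc t by auto
  have "r \<noteq> \<zero>"
  proof
    assume "r = \<zero>"
    then have "f = v" using v(3) vc by simp
    then show False using f v(1) k(2)[of m] m by blast
  qed
  have w: "v \<otimes> t \<oplus> c \<in> poly_values K t k"
    using poly_values_SucI[OF v(1) f(2)] m by simp
  have "r \<otimes> t [^] k = (\<ominus> \<one>) \<otimes> (v \<otimes> t \<oplus> c) \<oplus> (f \<otimes> t \<oplus> c)"
    unfolding v(3) m nat_pow_Suc using vc cc t by algebra
  also have "\<dots> = (\<ominus> \<one>) \<otimes> (v \<otimes> t \<oplus> c)" unfolding f(3) using vc cc t by simp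
  finally have "r \<otimes> t [^] k \<in> poly_values K t k"
    using poly_values_smult[OF K t subringE(5)[OF K subringE(3)[OF K]] w] by simp
  then show ?thesis using v(2) \<open>r \<noteq> \<zero>\<close> by blast
qed

text \<open>The exchange property: a relation for \<open>u\<close> over \<open>P[z]\<close> is rearranged by powers of \<open>z\<close>.\<close>

lemma free_over_swap:
  assumes P: "subring P R" and u: "u \<in> carrier R" and z: "z \<in> carrier R" "z \<noteq> \<zero>"
    and free_u: "free_over P u" and free_z: "free_over (simple_extension P u) z"
  shows "free_over (simple_extension P z) u"
proof -
  define Q where "Q = simple_extension P u"
  have Q: "subring Q R" unfolding Q_def using simple_extension_is_subring[OF P u] .
  note Pc = subringE(1)[OF P] and Qc = subringE(1)[OF Q]
  have uQ: "u \<in> Q" "P \<subseteq> Q"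
    unfolding Q_def using simple_extension_mem[OF P u] simple_extension_incl[OF Pc u] by auto
  \<comment> \<open>Read as a polynomial in \<open>z\<close> over \<open>P[u]\<close>, the relation
    has constant coefficient \<open>f0 u + c0\<close>. This vanishes because \<open>z\<close> is
    free over \<open>P[u]\<close>, so \<open>c0\<close> vanishes because \<open>u\<close> is free
    over \<open>P\<close>. Cancelling \<open>z\<close> leaves a shorter relation.\<close>
  have coeff: "c \<in> poly_values P z n \<Longrightarrow> f \<in> poly_values Q z n \<Longrightarrow> f \<otimes> u \<oplus> c = \<zero> \<Longrightarrow> c = \<zero>" for n c f
  proof (induction n arbitrary: c f)
    case (Suc n)
    obtain c' c0 where c: "c' \<in> poly_values P z n" "c0 \<in> P" "c = c' \<otimes> z \<oplus> c0" using Suc.prems by auto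
    obtain f' f0 where f: "f' \<in> poly_values Q z n" "f0 \<in> Q" "f = f' \<otimes> z \<oplus> f0" using Suc.prems by auto
    have cc: "c' \<in> carrier R" "c0 \<in> carrier R" "f' \<in> carrier R" "f0 \<in> carrier R"
      using poly_values_closed[OF Pc z(1) c(1)] poly_values_closed[OF Qc z(1) f(1)] c f Pc Qc by auto
    define g where "g = f' \<otimes> u \<oplus> c'"
    have "u \<otimes> f' \<in> poly_values Q z n" "c' \<in> poly_values Q z n"
      using poly_values_smult[OF Q z(1) uQ(1) f(1)] poly_values_subset[OF uQ(2)] c(1) by auto
    then have "g \<in> poly_values Q z n"
      unfolding g_def using poly_values_add[OF Q z(1)] cc u by (simp add: m_comm)
    then have g: "g \<in> simple_extension Q z" unfolding simple_extension_eq_poly_values by blast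
    have gc: "g \<in> carrier R" unfolding g_def using cc u by simp
    have d: "f0 \<otimes> u \<oplus> c0 \<in> Q" using f(2) c(2) uQ by (simp add: subringE(6,7)[OF Q] subsetD)
    have eq: "g \<otimes> z \<oplus> (f0 \<otimes> u \<oplus> c0) = f \<otimes> u \<oplus> c"
      unfolding g_def c(3) f(3) using cc u z(1) by algebra
    then have 0: "f0 \<otimes> u \<oplus> c0 = \<zero>"
      using free_overD[OF free_z[folded Q_def] g d] Suc.prems(3) by simp
    then have c0: "c0 = \<zero>" using free_overD[OF free_u _ c(2)] f(2) unfolding Q_def by blast
    have "g \<otimes> z = \<zero>" using eq Suc.prems(3) 0 gc z(1) by simp
    then have "g = \<zero>" using integral gc z by blast
    then have "c' = \<zero>" using Suc.IH[OF c(1) f(1)] unfolding g_def by blast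
    then show ?case unfolding c(3) c0 using z by simp
  qed simp
  have sub: "simple_extension (simple_extension P z) u \<subseteq> simple_extension Q z"
    using simple_extension_subring_incl[OF simple_extension_is_subring[OF Q z(1)]
        mono_simple_extension[OF uQ(2)]] simple_extension_incl[OF Qc z(1)] uQ(1) by blast
  show ?thesis
    unfolding free_over_def
  proof (intro ballI impI)
    fix f c assume f: "f \<in> simple_extension (simple_extension P z) u" and c: "c \<in> simple_extension P z"
      and eq: "f \<otimes> u \<oplus> c = \<zero>"
    obtain n where n: "f \<in> poly_values Q z n" using subsetD[OF sub f] unfolding simple_extension_eq_poly_values by blast
    obtain m where m: "c \<in> poly_values P z m" using c unfolding simple_extension_eq_poly_values by blast
    show "c = \<zero>"
      using coeff[OF poly_values_mono[OF P z(1) _ m] poly_values_mono[OF Q z(1) _ n] eq, of "max n m"] by simp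
  qed
qed

text \<open>A polynomial has finitely many coefficients, and these lie in a single member of the
  chain. This makes transcendence pass to unions of chains.\<close>

lemma simple_extension_Union_chain:
  assumes "C \<noteq> {}" and lin: "\<And>S S'. S \<in> C \<Longrightarrow> S' \<in> C \<Longrightarrow> S \<subseteq> S' \<or> S' \<subseteq> S"
    and "f \<in> simple_extension (\<Union>C) u"
  shows "\<exists>S\<in>C. f \<in> simple_extension S u"
  using assms(3)
proof induction
  case zero
  then show ?case using assms(1) simple_extension.zero by blast
next
  case (lin k1 k2)
  then obtain S S' where S: "S \<in> C" "k1 \<in> simple_extension S u" "S' \<in> C" "k2 \<in> S'" by blast
  show ?case
  proof (cases "S \<subseteq> S'")
    case True
    then have "k1 \<in> simple_extension S' u" using mono_simple_extension S(2) by blast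
    then show ?thesis using simple_extension.lin S(3,4) by blast
  next
    case False
    then have "k2 \<in> S" using assms(2)[OF S(1,3)] S(4) by blast
    then show ?thesis using simple_extension.lin S(1,2) by blast
  qed
qed

text \<open>For \<open>P\<close> maximal with \<open>u\<close> transcendental over it,
  \<open>P[u]\<close> meets the hypotheses of \<open>maximal_subring_of_prime_unit\<close>: the
  quotient of \<open>P[u]\<close> by \<open>u\<close> is the domain \<open>P\<close>, degrees bound
  divisibility by \<open>u\<close>, and the exchange property makes everything algebraic over
  \<open>P[u]\<close>.\<close>

theorem maximal_subring_of_transcendental_unit:
  assumes P0: "subring P0 R" and u: "u \<in> Units R" and "free_over P0 u"
  shows "\<exists>M. maximal_subring M R"
proof -
  have uc: "u \<in> carrier R" "inv u \<in> carrier R" "inv u \<otimes> u = \<one>" using u by auto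
  have u0: "u \<noteq> \<zero>" using uc by auto
  obtain P where P: "subring P R" "free_over P u"
    and Pmax: "\<And>S. subring S R \<Longrightarrow> P \<subseteq> S \<Longrightarrow> free_over S u \<Longrightarrow> S = P"
  proof (rule subring_maximal_exists[OF P0, of "\<lambda>S. free_over S u"])
    fix C assume C: "C \<noteq> {}" "\<And>S. S \<in> C \<Longrightarrow> subring S R \<and> P0 \<subseteq> S \<and> free_over S u"
      and lin: "\<And>S S'. S \<in> C \<Longrightarrow> S' \<in> C \<Longrightarrow> S \<subseteq> S' \<or> S' \<subseteq> S"
    show "free_over (\<Union>C) u"
      unfolding free_over_def
    proof (intro ballI impI)
      fix f c assume f: "f \<in> simple_extension (\<Union>C) u" and c: "c \<in> \<Union>C" and eq: "f \<otimes> u \<oplus> c = \<zero>"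
      obtain S where S: "S \<in> C" "f \<in> simple_extension S u"
        using simple_extension_Union_chain[OF C(1) lin f] by blast
      obtain S' where S': "S' \<in> C" "c \<in> S'" using c by blast
      consider "S \<subseteq> S'" | "S' \<subseteq> S" using lin[OF S(1) S'(1)] by blast
      then show "c = \<zero>"
      proof cases
        case 1
        then have "f \<in> simple_extension S' u" using mono_simple_extension S(2) by blast
        then show ?thesis using free_overD[of S' u f c] C(2)[OF S'(1)] S'(2) eq by blast
      next
        case 2
        then show ?thesis using free_overD[of S u f c] C(2)[OF S(1)] S(2) S'(2) eq by blast
      qed
    qed
  qed (use assms(3) in \<open>simp, blast\<close>)
  define F where "F = simple_extension P u"
  have F: "subring F R" unfolding F_def using simple_extension_is_subring[OF P(1) uc(1)] .
  note Pc = subringE(1)[OF P(1)] and Fc = subringE(1)[OF F]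
  have uF: "u \<in> F" "P \<subseteq> F"
    unfolding F_def using simple_extension_mem[OF P(1) uc(1)] simple_extension_incl[OF Pc uc(1)] by auto
  \<comment> \<open>Divisibility by \<open>u\<close> in \<open>F\<close> is read off from the
    constant coefficient: subtracting the quotient \<open>g\<close> from \<open>f'\<close> gives a
    relation of \<open>u\<close> over \<open>P\<close> with constant coefficient
    \<open>c\<close>.\<close>
  have const: "c = \<zero>" if f': "f' \<in> F" and c: "c \<in> P" and i: "inv u \<otimes> (f' \<otimes> u \<oplus> c) \<in> F" for f' c
  proof -
    define g where "g = inv u \<otimes> (f' \<otimes> u \<oplus> c)"
    have cc: "f' \<in> carrier R" "c \<in> carrier R" "g \<in> carrier R" using f' c i Pc Fc unfolding g_def by auto
    have "g \<otimes> u = (inv u \<otimes> u) \<otimes> (f' \<otimes> u \<oplus> c)"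
      unfolding g_def using cc uc(1,2) by (simp add: m_ac)
    then have gu: "g \<otimes> u = f' \<otimes> u \<oplus> c" using uc cc by simp
    have "(f' \<ominus> g) \<otimes> u \<oplus> c = (f' \<otimes> u \<oplus> c) \<ominus> g \<otimes> u" using cc uc(1) by algebra
    also have "\<dots> = \<zero>" unfolding gu using cc uc(1) by simp
    finally have "(f' \<ominus> g) \<otimes> u \<oplus> c = \<zero>" .
    moreover have "f' \<ominus> g \<in> simple_extension P u"
      unfolding a_minus_def F_def[symmetric] using f' i g_def by (simp add: subringE(5,7)[OF F])
    ultimately show ?thesis using free_overD[OF P(2) _ c] by blast
  qed
  have decomp: "\<exists>f'\<in>F. \<exists>c\<in>P. f = f' \<otimes> u \<oplus> c" if "f \<in> F" for f
    using simple_extensionE[OF P(1) uc(1)] that unfolding F_def by metis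
  have shift: "inv u \<otimes> (f' \<otimes> u) = f'" if "f' \<in> carrier R" for f'
  proof -
    have "inv u \<otimes> (f' \<otimes> u) = (inv u \<otimes> u) \<otimes> f'" using that uc(1,2) by (simp add: m_ac)
    then show ?thesis using uc(3) that by simp
  qed
  show ?thesis
  proof (rule maximal_subring_of_prime_unit[OF F uF(1) u])
    show "inv u \<notin> F"
    proof
      assume "inv u \<in> F"
      then have "inv u \<otimes> (\<zero> \<otimes> u \<oplus> \<one>) \<in> F" using uc by simp
      then show False using const[of \<zero> \<one>] subringE(2)[OF F] subringE(3)[OF P(1)] by simp
    qed
  next
    fix f g assume f: "f \<in> F" and g: "g \<in> F" and fg: "inv u \<otimes> (f \<otimes> g) \<in> F"
    obtain f' c where f': "f' \<in> F" "c \<in> P" "f = f' \<otimes> u \<oplus> c" using decomp[OF f] by blast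
    obtain g' d where g': "g' \<in> F" "d \<in> P" "g = g' \<otimes> u \<oplus> d" using decomp[OF g] by blast
    have cc: "f' \<in> carrier R" "c \<in> carrier R" "g' \<in> carrier R" "d \<in> carrier R" using f' g' Pc Fc by auto
    define h where "h = f' \<otimes> g' \<otimes> u \<oplus> (f' \<otimes> d \<oplus> c \<otimes> g')"
    have h: "h \<in> F" unfolding h_def
      using f'(1,2) g'(1,2) uF by (simp add: subringE(6,7)[OF F] subsetD[OF uF(2)])
    have "f \<otimes> g = h \<otimes> u \<oplus> c \<otimes> d"
      unfolding h_def f'(3) g'(3) using cc uc(1) by algebra
    then have "c \<otimes> d = \<zero>" using const[OF h subringE(6)[OF P(1) f'(2) g'(2)]] fg by simp
    then have "c = \<zero> \<or> d = \<zero>" using integral cc by blast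
    then show "inv u \<otimes> f \<in> F \<or> inv u \<otimes> g \<in> F"
    proof
      assume "c = \<zero>"
      then have "inv u \<otimes> f = f'" unfolding f'(3) using shift[OF cc(1)] cc uc(1) by simp
      then show ?thesis using f'(1) by simp
    next
      assume "d = \<zero>"
      then have "inv u \<otimes> g = g'" unfolding g'(3) using shift[OF cc(3)] cc uc(1) by simp
      then show ?thesis using g'(1) by simp
    qed
  next
    fix f assume f: "f \<in> F" and div: "\<And>n::nat. inv u [^] n \<otimes> f \<in> F"
    \<comment> \<open>Each division by \<open>u\<close> removes a vanishing constant coefficient and
      lowers the degree bound by one.\<close>
    have "f \<in> poly_values P u n \<Longrightarrow> (\<And>j::nat. inv u [^] j \<otimes> f \<in> F) \<Longrightarrow> f = \<zero>" for n f
    proof (induction n arbitrary: f)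
      case (Suc n)
      obtain f' c where f': "f' \<in> poly_values P u n" "c \<in> P" "f = f' \<otimes> u \<oplus> c" using Suc.prems(1) by auto
      have fF: "f' \<in> F" unfolding F_def simple_extension_eq_poly_values using f'(1) by blast
      have cc: "f' \<in> carrier R" "c \<in> carrier R" using fF f' Pc Fc by auto
      have "inv u \<otimes> f \<in> F" using Suc.prems(2)[of 1] uc cc f' by simp
      then have "c = \<zero>" using const[OF fF f'(2)] f'(3) by simp
      then have ff: "f = f' \<otimes> u" using f'(3) cc uc(1) by simp
      have "inv u [^] j \<otimes> f' \<in> F" for j :: nat
      proof -
        have "inv u [^] Suc j \<otimes> f = inv u [^] j \<otimes> (inv u \<otimes> (f' \<otimes> u))"
          unfolding ff using cc uc by (simp add: m_assoc)
        then show ?thesis using Suc.prems(2)[of "Suc j"] shift[OF cc(1)] by simp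
      qed
      then have "f' = \<zero>" using Suc.IH[OF f'(1)] by blast
      then show ?case using ff uc(1) by simp
    qed simp
    then show "f = \<zero>" using f div unfolding F_def simple_extension_eq_poly_values by blast
  next
    fix t assume t: "t \<in> carrier R"
    \<comment> \<open>If \<open>t\<close> were transcendental over \<open>P[u]\<close>, then
      \<open>u\<close> would be transcendental over \<open>P[t]\<close> by exchange, so
      \<open>P[t] = P\<close> by maximality. Then \<open>t\<close> lies in \<open>F\<close>, where
      \<open>t + (-t) = 0\<close> is a relation with nonzero constant coefficient.\<close>
    have "t = \<zero> \<or> \<not> free_over F t"
    proof (rule ccontr)
      assume "\<not> ?thesis"
      then have t0: "t \<noteq> \<zero>" and ft: "free_over F t" by auto
      have "free_over (simple_extension P t) u"
        using free_over_swap[OF P(1) uc(1) t t0 P(2)] ft unfolding F_def by blast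
      then have "simple_extension P t = P"
        using Pmax[OF simple_extension_is_subring[OF P(1) t] simple_extension_incl[OF Pc t]] by blast
      then have "t \<in> F" using simple_extension_mem[OF P(1) t] uF by blast
      then have "\<ominus> t \<in> F" using subringE(5)[OF F] by blast
      moreover have "\<one> \<in> simple_extension F t"
        using simple_extension_incl[OF Fc t] subringE(3)[OF F] by blast
      moreover have "\<one> \<otimes> t \<oplus> \<ominus> t = \<zero>" using t by (simp add: r_neg)
      ultimately have "\<ominus> t = \<zero>" using free_overD[OF ft] by blast
      then show False using t0 t by (metis minus_minus minus_zero)
    qed
    then show "\<exists>k. \<exists>a\<in>F - {\<zero>}. a \<otimes> t [^] (k::nat) \<in> poly_values F t k"
      by (rule algebraic_leading_coeff[OF F t])
  qed
qed

text \<open>There are countably many polynomials over \<open>K\<close>, and each nonzero one has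
  finitely many roots in a domain.\<close>

lemma countable_not_free:
  assumes K: "subring K R" "countable K"
  shows "countable {x \<in> carrier R. \<not> free_over K x}"
proof -
  let ?L = "{p. set p \<subseteq> K \<and> p \<in> carrier (poly_ring R)}"
  note Kc = subringE(1)[OF K(1)]
  have "{x \<in> carrier R. \<not> free_over K x} \<subseteq> (\<Union>p\<in>?L. {x. is_root p x})"
  proof
    fix x assume "x \<in> {x \<in> carrier R. \<not> free_over K x}"
    then obtain f c where x: "x \<in> carrier R" and f: "f \<in> simple_extension K x" "c \<in> K"
      "f \<otimes> x \<oplus> c = \<zero>" "c \<noteq> \<zero>" unfolding free_over_def by blast
    obtain p where "p \<in> carrier (K[X])" "f = eval p x"
      using f(1) unfolding simple_extension_as_eval_img[OF Kc x] by blast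
    then have p: "polynomial K p" "f = eval p x" by (simp_all add: univ_poly_carrier)
    then have pc: "set p \<subseteq> K" "set p \<subseteq> carrier R" using polynomial_incl Kc by blast+
    \<comment> \<open>Coefficient lists begin with the leading coefficient, so appending
      \<open>c\<close> produces \<open>X p + c\<close>. As \<open>c\<close> is nonzero, this is a
      valid nonempty list even for empty \<open>p\<close>.\<close>
    have "eval (p @ [c]) x = \<zero>"
      using eval_append_aux[OF pc(2) _ x, of c] f Kc p(2) by auto
    moreover have "polynomial (carrier R) (p @ [c])"
      using p(1) f(2,4) Kc pc unfolding polynomial_def by (cases p) auto
    ultimately have "is_root (p @ [c]) x" "p @ [c] \<in> ?L"
      using x pc f(2) unfolding is_root_def by (simp_all add: univ_poly_carrier)
    then show "x \<in> (\<Union>p\<in>?L. {x. is_root p x})" by blast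
  qed
  moreover have "countable ?L"
    by (rule countable_subset[OF _ countable_lists[OF K(2)]]) auto
  moreover have "countable {x. is_root p x}" if "p \<in> ?L" for p
    using finite_number_of_roots that by (blast intro: countable_finite)
  ultimately show ?thesis by (meson countable_UN countable_subset)
qed

end

section \<open>Countable subrings and pullback of maximal subrings\<close>

lemma (in ring) countable_subring_exists: "\<exists>K. subring K R \<and> countable K"
proof -
  let ?K = "range (\<lambda>k::int. add_pow R k \<one>)"
  have "subring ?K R"
  proof (rule subringI)
    show "?K \<subseteq> carrier R" by auto
    show "\<one> \<in> ?K" by (rule range_eqI[of _ _ 1]) simp
    show "\<ominus> h \<in> ?K" if "h \<in> ?K" for h
      using that add.int_pow_neg[OF one_closed] by (metis (no_types, lifting) a_inv_def imageE rangeI)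
    show "h1 \<otimes> h2 \<in> ?K" if h: "h1 \<in> ?K" "h2 \<in> ?K" for h1 h2
    proof -
      obtain k l :: int where "h1 = add_pow R k \<one>" "h2 = add_pow R l \<one>" using h by blast
      then have "h1 \<otimes> h2 = add_pow R (l * k) \<one>"
        by (simp add: add_pow_ldistr_int add.int_pow_pow)
      then show ?thesis by blast
    qed
    show "h1 \<oplus> h2 \<in> ?K" if h: "h1 \<in> ?K" "h2 \<in> ?K" for h1 h2
    proof -
      obtain k l :: int where "h1 = add_pow R k \<one>" "h2 = add_pow R l \<one>" using h by blast
      then have "h1 \<oplus> h2 = add_pow R (k + l) \<one>" by (simp add: add.int_pow_mult)
      then show ?thesis by blast
    qed
  qed
  then show ?thesis by blast
qed

text \<open>Subrings above the preimage of \<open>B\<close> contain the kernel, so a proper one has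
  a proper image, and that image must be \<open>B\<close>. This carries maximal subrings of residue
  fields back to the ring.\<close>

lemma (in ring_hom_ring) maximal_subring_vimage:
  assumes surj: "h ` carrier R = carrier S" and B: "maximal_subring B S"
  shows "maximal_subring {t \<in> carrier R. h t \<in> B} R"
proof -
  let ?A = "{t \<in> carrier R. h t \<in> B}"
  have Bs: "subring B S" "B \<noteq> carrier S"
    and Bmax: "\<And>S'. subring S' S \<Longrightarrow> B \<subseteq> S' \<Longrightarrow> S' \<noteq> carrier S \<Longrightarrow> S' = B"
    using B unfolding maximal_subring_def by auto
  note Bc = subringE(1)[OF Bs(1)]
  have A: "subring ?A R"
    by (rule R.subringI) (auto simp: subringE(3,5,6,7)[OF Bs(1)])
  have imgA: "B \<subseteq> h ` ?A"
  proof
    fix b assume b: "b \<in> B"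
    then obtain t where "t \<in> carrier R" "h t = b" using surj Bc by (metis imageE subsetD)
    then show "b \<in> h ` ?A" using b by blast
  qed
  have "S' = ?A" if S': "subring S' R" "?A \<subseteq> S'" "S' \<noteq> carrier R" for S'
  proof -
    note Sc = subringE(1)[OF S'(1)]
    have "h ` S' \<noteq> carrier S"
    proof
      assume full: "h ` S' = carrier S"
      have "r \<in> S'" if r: "r \<in> carrier R" for r
      proof -
        obtain s where s: "s \<in> S'" "h s = h r" using full hom_closed[OF r] by (metis imageE)
        have sc: "s \<in> carrier R" using s Sc by blast
        have "h (r \<ominus>\<^bsub>R\<^esub> s) = \<zero>\<^bsub>S\<^esub>" using s(2) r sc by (simp add: R.minus_eq S.r_neg)
        then have "r \<ominus>\<^bsub>R\<^esub> s \<in> S'" using S'(2) r sc subringE(2)[OF Bs(1)] by auto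
        then have "(r \<ominus>\<^bsub>R\<^esub> s) \<oplus>\<^bsub>R\<^esub> s \<in> S'" using subringE(7)[OF S'(1)] s(1) by blast
        moreover have "(r \<ominus>\<^bsub>R\<^esub> s) \<oplus>\<^bsub>R\<^esub> s = r"
          using r sc by (simp add: R.minus_eq R.a_assoc R.l_neg)
        ultimately show ?thesis by simp
      qed
      then show False using S'(3) Sc by blast
    qed
    moreover have "B \<subseteq> h ` S'" using imgA S'(2) by blast
    ultimately have "h ` S' = B" using Bmax[OF img_is_subring[OF S'(1)]] by blast
    then show ?thesis using S'(2) Sc by blast
  qed
  moreover have "?A \<noteq> carrier R" 
  proof
    assume "?A = carrier R"
    then have "h ` carrier R \<subseteq> B" by blast
    then show False using Bs(2) Bc surj by blast
  qed
  ultimately show ?thesis using A unfolding maximal_subring_def by blast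
qed

section \<open>Maximal ideals and equalizers of ring homomorphisms\<close>

text \<open>One application of Zorn's lemma with two uses: \<open>S = {\<one>}\<close> leads to
  maximal ideals, a multiplicative \<open>S\<close> to prime ideals.\<close>

lemma (in cring) ideal_maximal_disjoint_exists:
  assumes "ideal I R" and "I \<inter> S = {}"
  obtains Q where "ideal Q R" "I \<subseteq> Q" "Q \<inter> S = {}"
    "\<And>J. ideal J R \<Longrightarrow> Q \<subseteq> J \<Longrightarrow> J \<inter> S = {} \<Longrightarrow> J = Q"
proof -
  let ?\<A> = "{J. ideal J R \<and> I \<subseteq> J \<and> J \<inter> S = {}}"
  have "\<exists>M\<in>?\<A>. \<forall>J\<in>?\<A>. M \<subseteq> J \<longrightarrow> J = M"
  proof (rule subset_Zorn_nonempty)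
    show "?\<A> \<noteq> {}" using assms by blast
  next
    fix C assume C0: "C \<noteq> {}" and "subset.chain ?\<A> C"
    then have C: "J \<in> C \<Longrightarrow> ideal J R \<and> I \<subseteq> J \<and> J \<inter> S = {}"
      and lin: "J \<in> C \<Longrightarrow> J' \<in> C \<Longrightarrow> J \<subseteq> J' \<or> J' \<subseteq> J" for J J'
      by (auto simp: subset_chain_def)
    have sub: "additive_subgroup J R" if "J \<in> C" for J using C[OF that] ideal.axioms(1) by blast
    obtain J0 where J0: "J0 \<in> C" using C0 by blast
    have "ideal (\<Union>C) R"
    proof (rule idealI[OF ring_axioms])
      show "subgroup (\<Union>C) (add_monoid R)"
      proof (rule add.subgroupI)
        show "\<Union>C \<subseteq> carrier R" using additive_subgroup.a_subset[OF sub] by blast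
        show "\<Union>C \<noteq> {}" using additive_subgroup.zero_closed[OF sub[OF J0]] J0 by blast
      next
        fix a assume "a \<in> \<Union>C"
        then obtain J where J: "J \<in> C" "a \<in> J" by blast
        then have "\<ominus> a \<in> J" using additive_subgroup.a_inv_closed[OF sub] by blast
        then show "\<ominus> a \<in> \<Union>C" using J(1) by blast
      next
        fix a b assume "a \<in> \<Union>C" "b \<in> \<Union>C"
        then obtain J J' where J: "J \<in> C" "a \<in> J" "J' \<in> C" "b \<in> J'" by blast
        then obtain K where K: "K \<in> C" "a \<in> K" "b \<in> K" using lin[of J J'] by blast
        then show "a \<oplus> b \<in> \<Union>C" using additive_subgroup.a_closed[OF sub[OF K(1)] K(2,3)] by blast
      qed
    next
      fix a x assume "a \<in> \<Union>C" and x: "x \<in> carrier R"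
      then obtain J where J: "J \<in> C" "a \<in> J" by blast
      have "ideal J R" using C[OF J(1)] by blast
      then show "x \<otimes> a \<in> \<Union>C" "a \<otimes> x \<in> \<Union>C"
        using ideal.I_l_closed[OF _ J(2) x] ideal.I_r_closed[OF _ J(2) x] J(1) by blast+
    qed
    moreover have "I \<subseteq> \<Union>C" using C[OF J0] J0 by blast
    moreover have "\<Union>C \<inter> S = {}" using C by blast
    ultimately show "\<Union>C \<in> ?\<A>" by blast
  qed
  then obtain Q where Q: "Q \<in> ?\<A>" "\<forall>J\<in>?\<A>. Q \<subseteq> J \<longrightarrow> J = Q" by (elim bexE)
  then show ?thesis using that[of Q] by auto
qed

text \<open>For \<open>a\<close> and \<open>b\<close> outside a maximal choice of \<open>Q\<close>,
  both \<open>Q + (a)\<close> and \<open>Q + (b)\<close> meet \<open>S\<close>. If \<open>ab\<close>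
  were in \<open>Q\<close>, the product of two such elements would lie in both \<open>Q\<close> and
  \<open>S\<close>.\<close>

lemma (in cring) primeideal_disjoint_exists:
  assumes I: "ideal I R" "I \<inter> S = {}" and S: "S \<subseteq> carrier R" "\<one> \<in> S"
    and mult: "\<And>s s'. s \<in> S \<Longrightarrow> s' \<in> S \<Longrightarrow> s \<otimes> s' \<in> S"
  obtains Q where "primeideal Q R" "I \<subseteq> Q" "Q \<inter> S = {}"
proof -
  obtain Q where Q: "ideal Q R" "I \<subseteq> Q" "Q \<inter> S = {}"
    and Qmax: "\<And>J. ideal J R \<Longrightarrow> Q \<subseteq> J \<Longrightarrow> J \<inter> S = {} \<Longrightarrow> J = Q"
    using ideal_maximal_disjoint_exists[OF I] by blast
  interpret Q: ideal Q R by (rule Q(1))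
  have meet: "\<exists>q\<in>Q. \<exists>r\<in>carrier R. q \<oplus> r \<otimes> a \<in> S" if a: "a \<in> carrier R" "a \<notin> Q" for a
  proof -
    let ?J = "set_add R Q (PIdl a)"
    have J: "ideal ?J R" using add_ideals[OF Q(1) cgenideal_ideal[OF a(1)]] .
    have mem: "q \<oplus> r \<otimes> a \<in> ?J" if "q \<in> Q" "r \<in> carrier R" for q r
      using that unfolding set_add_def' cgenideal_def by blast
    have "a \<in> ?J" using mem[OF Q.zero_closed one_closed] a(1) by simp
    moreover have "Q \<subseteq> ?J"
    proof
      fix q assume "q \<in> Q"
      then show "q \<in> ?J" using mem[of q \<zero>] a(1) Q.Icarr by simp
    qed
    ultimately have "?J \<inter> S \<noteq> {}" using Qmax[OF J] a(2) by blast
    then show ?thesis unfolding set_add_def' cgenideal_def by blast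
  qed
  have "primeideal Q R"
  proof (rule primeidealI[OF Q(1) is_cring])
    show "carrier R \<noteq> Q" using Q(3) S by blast
    fix a b assume a: "a \<in> carrier R" and b: "b \<in> carrier R" and ab: "a \<otimes> b \<in> Q"
    show "a \<in> Q \<or> b \<in> Q"
    proof (rule ccontr)
      assume "\<not> ?thesis"
      then obtain q r q' r' where q: "q \<in> Q" "r \<in> carrier R" "q \<oplus> r \<otimes> a \<in> S"
        and q': "q' \<in> Q" "r' \<in> carrier R" "q' \<oplus> r' \<otimes> b \<in> S"
        using meet[OF a] meet[OF b] by blast
      have c: "q \<in> carrier R" "q' \<in> carrier R" using q q' Q.Icarr by auto
      have "(q \<oplus> r \<otimes> a) \<otimes> (q' \<oplus> r' \<otimes> b) =
          (q' \<oplus> r' \<otimes> b) \<otimes> q \<oplus> ((r \<otimes> a) \<otimes> q' \<oplus> (r \<otimes> r') \<otimes> (a \<otimes> b))"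
        using c q(2) q'(2) a b by algebra
      moreover have "\<dots> \<in> Q"
        using q(1,2) q'(1,2) a b ab c
        by (intro Q.a_closed Q.I_l_closed[OF q(1)] Q.I_l_closed[OF q'(1)] Q.I_l_closed[OF ab]) auto
      ultimately show False using mult[OF q(3) q'(3)] Q(3) by auto
    qed
  qed
  then show ?thesis using that Q by blast
qed

section \<open>Maximal ideals, units and dimension one\<close>

lemma (in cring) maximalideal_exists:
  assumes "ideal I R" "I \<noteq> carrier R"
  obtains M where "maximalideal M R" "I \<subseteq> M"
proof -
  have "I \<inter> {\<one>} = {}" using ideal.one_imp_carrier[OF assms(1)] assms(2) by blast
  then obtain M where M: "ideal M R" "I \<subseteq> M" "M \<inter> {\<one>} = {}"
    and Mmax: "\<And>J. ideal J R \<Longrightarrow> M \<subseteq> J \<Longrightarrow> J \<inter> {\<one>} = {} \<Longrightarrow> J = M"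
    using ideal_maximal_disjoint_exists[OF assms(1)] by blast
  have "maximalideal M R"
  proof (rule maximalidealI[OF M(1)])
    show "carrier R \<noteq> M" using M(3) by auto
    fix J assume "ideal J R" "M \<subseteq> J" "J \<subseteq> carrier R"
    then show "J = M \<or> J = carrier R" using Mmax[of J] ideal.one_imp_carrier[of J R] by blast
  qed
  then show ?thesis using that M(2) by blast
qed

lemma (in cring) Units_if_no_maximalideal:
  assumes u: "u \<in> carrier R" and "\<And>M. maximalideal M R \<Longrightarrow> u \<notin> M"
  shows "u \<in> Units R"
proof -
  have "PIdl u = carrier R"
    using maximalideal_exists[OF cgenideal_ideal[OF u]] cgenideal_self[OF u] assms(2) by blast
  then have "\<one> \<in> PIdl u" by simp
  then obtain v where "v \<in> carrier R" "v \<otimes> u = \<one>" unfolding cgenideal_def by auto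
  then show ?thesis using u m_comm[of u v] unfolding Units_def by auto
qed

text \<open>If \<open>P\<close> were strictly below a maximal ideal \<open>M\<close>, then
  \<open>{\<zero>}\<close>, \<open>P\<close>, \<open>M\<close> would form a prime chain of length
  2.\<close>

lemma (in domain) krull_dim_1_maximalideal:
  assumes "krull_dim R = 1" and P: "primeideal P R" "P \<noteq> {\<zero>}"
  shows "maximalideal P R"
proof -
  interpret P: primeideal P R by (rule P(1))
  obtain M where M: "maximalideal M R" "P \<subseteq> M"
    using maximalideal_exists[OF P.is_ideal] P.I_notcarr by metis
  have "P = M"
  proof (rule ccontr)
    assume "P \<noteq> M"
    define c :: "nat \<Rightarrow> 'a set" where "c = (\<lambda>i. if i = 0 then {\<zero>} else if i = 1 then P else M)"
    have "{\<zero>} \<subset> P" using P(2) P.zero_closed by blast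
    then have "prime_chain R 2"
      unfolding prime_chain_def using M \<open>P \<noteq> M\<close> P(1) zeroprimeideal maximalideal_prime[OF M(1)]
      by (intro exI[of _ c]) (auto simp: c_def less_2_cases_iff)
    then have "enat 2 \<le> krull_dim R" unfolding krull_dim_def by (intro Sup_upper) blast
    then show False using assms(1) by (simp add: one_enat_def)
  qed
  then show ?thesis using M(1) by simp
qed

text \<open>A multiple \<open>b\<close> of \<open>a\<close> has images \<open>0\<close> and
  \<open>1\<close>, so \<open>h1\<close> and \<open>h2\<close> together map onto
  \<open>A \<times> A\<close>. The equalizer is the preimage of the diagonal, which is a maximal
  subring of \<open>A \<times> A\<close> because \<open>A\<close> is a field. The proof carries this
  out on elements.\<close>

lemma maximal_subring_equalizer:
  assumes "cring R" "field A"
    and h1: "h1 \<in> ring_hom R A" "h1 ` carrier R = carrier A"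
    and h2: "h2 \<in> ring_hom R A" "h2 ` carrier R = carrier A"
    and a: "a \<in> carrier R" "h1 a = \<zero>\<^bsub>A\<^esub>" "h2 a \<noteq> \<zero>\<^bsub>A\<^esub>"
  shows "maximal_subring {t \<in> carrier R. h1 t = h2 t} R"
proof -
  interpret R: cring R by fact
  interpret A: field A by fact
  interpret h1: ring_hom_ring R A h1
    by (rule ring_hom_ringI2[OF R.ring_axioms A.ring_axioms h1(1)])
  interpret h2: ring_hom_ring R A h2
    by (rule ring_hom_ringI2[OF R.ring_axioms A.ring_axioms h2(1)])
  have surj2: "\<exists>r\<in>carrier R. h2 r = \<alpha>" if "\<alpha> \<in> carrier A" for \<alpha> using that h2(2) by (metis imageE)
  have surj1: "\<exists>r\<in>carrier R. h1 r = \<alpha>" if "\<alpha> \<in> carrier A" for \<alpha> using that h1(2) by (metis imageE)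
  have div: "\<exists>w\<in>carrier A. w \<otimes>\<^bsub>A\<^esub> \<beta> = \<alpha>" if "\<alpha> \<in> carrier A" "\<beta> \<in> carrier A" "\<beta> \<noteq> \<zero>\<^bsub>A\<^esub>" for \<alpha> \<beta>
  proof -
    have "\<beta> \<in> Units A" using that A.field_Units by blast
    then have "(\<alpha> \<otimes>\<^bsub>A\<^esub> inv\<^bsub>A\<^esub> \<beta>) \<otimes>\<^bsub>A\<^esub> \<beta> = \<alpha>" "inv\<^bsub>A\<^esub> \<beta> \<in> carrier A"
      using that by (simp_all add: A.m_assoc)
    then show ?thesis using that(1) by blast
  qed
  let ?E = "{t \<in> carrier R. h1 t = h2 t}"
  have E: "subring ?E R" by (rule R.subringI) auto
  obtain c where c: "c \<in> carrier R" "h2 c \<otimes>\<^bsub>A\<^esub> h2 a = \<one>\<^bsub>A\<^esub>"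
    using div[of "\<one>\<^bsub>A\<^esub>" "h2 a"] a surj2 by (metis A.one_closed h2.hom_closed)
  define b where "b = c \<otimes>\<^bsub>R\<^esub> a"
  have b: "b \<in> carrier R" "h1 b = \<zero>\<^bsub>A\<^esub>" "h2 b = \<one>\<^bsub>A\<^esub>"
    unfolding b_def using c a by auto
  have lift: "\<exists>s\<in>?E. h1 s = \<alpha>" if \<alpha>: "\<alpha> \<in> carrier A" for \<alpha>
  proof -
    obtain s1 s2 where s: "s1 \<in> carrier R" "h1 s1 = \<alpha>" "s2 \<in> carrier R" "h2 s2 = \<alpha>"
      using surj1[OF \<alpha>] surj2[OF \<alpha>] by blast
    define s where "s = s1 \<otimes>\<^bsub>R\<^esub> (\<one>\<^bsub>R\<^esub> \<oplus>\<^bsub>R\<^esub> \<ominus>\<^bsub>R\<^esub> b) \<oplus>\<^bsub>R\<^esub> s2 \<otimes>\<^bsub>R\<^esub> b"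
    have "s \<in> carrier R" unfolding s_def using s b by simp
    moreover have "h1 s = \<alpha>" unfolding s_def using s b \<alpha> by simp
    moreover have "h2 s = \<alpha>" unfolding s_def using s b \<alpha> by (simp add: A.r_neg)
    ultimately show ?thesis by auto
  qed
  have "S' = ?E" if S': "subring S' R" "?E \<subseteq> S'" "S' \<noteq> carrier R" for S'
  proof (rule ccontr)
    assume "S' \<noteq> ?E"
    then obtain t where t: "t \<in> S'" "t \<notin> ?E" using S'(2) by blast
    have tc: "t \<in> carrier R" using t(1) subringE(1)[OF S'(1)] by blast
    obtain s where s: "s \<in> ?E" "h1 s = h1 t" using lift[OF h1.hom_closed[OF tc]] by blast
    have sc: "s \<in> carrier R" "h2 s = h1 t" using s by auto
    \<comment> \<open>Subtracting an element of the equalizer with the same \<open>h1\<close>-value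
      moves \<open>t\<close> to an element of \<open>S'\<close> with images \<open>0\<close> and
      something nonzero.\<close>
    define u where "u = t \<ominus>\<^bsub>R\<^esub> s"
    have uS: "u \<in> S'"
      unfolding u_def R.minus_eq using t(1) s(1) S'(2) by (simp add: subringE(5,7)[OF S'(1)] subset_iff)
    have uc: "u \<in> carrier R" unfolding u_def using tc sc by simp
    have u1: "h1 u = \<zero>\<^bsub>A\<^esub>" unfolding u_def R.minus_eq using tc sc s(2) by (simp add: A.r_neg)
    have u2: "h2 u \<noteq> \<zero>\<^bsub>A\<^esub>"
    proof
      assume "h2 u = \<zero>\<^bsub>A\<^esub>"
      then have "h2 t \<ominus>\<^bsub>A\<^esub> h1 t = \<zero>\<^bsub>A\<^esub>" unfolding u_def R.minus_eq using tc sc by (simp add: A.minus_eq)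
      then have "h2 t = h1 t" using tc by (simp add: A.r_right_minus_eq)
      then show False using t tc by simp
    qed
    \<comment> \<open>In the same way \<open>r\<close> is reduced to \<open>v\<close> with
      \<open>h1 v = 0\<close>. Some multiple \<open>w u\<close> with \<open>w\<close> in the
      equalizer has the same two images as \<open>v\<close>, and the remainder \<open>z\<close> is
      killed by both maps, hence lies in the equalizer.\<close>
    have "r \<in> S'" if r: "r \<in> carrier R" for r
    proof -
      obtain s' where s': "s' \<in> ?E" "h1 s' = h1 r" using lift[OF h1.hom_closed[OF r]] by blast
      have s'c: "s' \<in> carrier R" "h2 s' = h1 r" using s' by auto
      define v where "v = r \<ominus>\<^bsub>R\<^esub> s'"
      have vc: "v \<in> carrier R" unfolding v_def using r s'c by simp
      have v1: "h1 v = \<zero>\<^bsub>A\<^esub>" unfolding v_def R.minus_eq using r s'c s'(2) by (simp add: A.r_neg)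
      obtain \<omega> where \<omega>: "\<omega> \<in> carrier A" "\<omega> \<otimes>\<^bsub>A\<^esub> h2 u = h2 v"
        using div[OF h2.hom_closed[OF vc] h2.hom_closed[OF uc] u2] by blast
      obtain w where w: "w \<in> ?E" "h1 w = \<omega>" using lift[OF \<omega>(1)] by blast
      have wc: "w \<in> carrier R" "h2 w = \<omega>" using w by auto
      define z where "z = v \<ominus>\<^bsub>R\<^esub> w \<otimes>\<^bsub>R\<^esub> u"
      have zc: "z \<in> carrier R" unfolding z_def using vc wc uc by simp
      have "h1 z = \<zero>\<^bsub>A\<^esub>" "h2 z = \<zero>\<^bsub>A\<^esub>"
        unfolding z_def R.minus_eq using vc wc uc v1 u1 \<omega>(2) w(2) \<omega>(1) by (simp_all add: A.r_neg)
      then have "z \<in> S'" using zc S'(2) by auto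
      moreover have "s' \<in> S'" "w \<in> S'" using s'(1) w(1) S'(2) by auto
      ultimately have "s' \<oplus>\<^bsub>R\<^esub> (w \<otimes>\<^bsub>R\<^esub> u \<oplus>\<^bsub>R\<^esub> z) \<in> S'"
        using uS by (simp add: subringE(6,7)[OF S'(1)])
      moreover have "s' \<oplus>\<^bsub>R\<^esub> (w \<otimes>\<^bsub>R\<^esub> u \<oplus>\<^bsub>R\<^esub> z) = r"
        unfolding z_def v_def using s'c wc uc r by algebra
      ultimately show ?thesis by simp
    qed
    then show False using S'(3) subringE(1)[OF S'(1)] by blast
  qed
  moreover have "a \<notin> ?E" using a by simp
  then have "?E \<noteq> carrier R" using a(1) by blast
  ultimately show ?thesis using E unfolding maximal_subring_def by blast
qed

section \<open>Residue fields of a domain without maximal subrings\<close>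

lemma (in ring_hom_ring) simple_extension_image:
  assumes "K \<subseteq> carrier R" "t \<in> carrier R" "f \<in> ring.simple_extension S (h ` K) (h t)"
  shows "\<exists>f'\<in>ring.simple_extension R K t. f = h f'"
  using assms(3)
proof (induction rule: S.simple_extension.induct)
  case zero
  then show ?case using R.simple_extension.zero by (metis hom_zero)
next
  case (lin k1 k2)
  then obtain f' c where f': "f' \<in> R.simple_extension K t" "k1 = h f'" "c \<in> K" "k2 = h c" by blast
  have "f' \<in> carrier R" "c \<in> carrier R"
    using subsetD[OF R.simple_extension_in_carrier[OF assms(1,2)] f'(1)] subsetD[OF assms(1) f'(3)] .
  then have "k1 \<otimes>\<^bsub>S\<^esub> h t \<oplus>\<^bsub>S\<^esub> k2 = h (f' \<otimes>\<^bsub>R\<^esub> t \<oplus>\<^bsub>R\<^esub> c)" using f' assms(2) by simp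
  then show ?case using R.simple_extension.lin[OF f'(1,3)] by blast
qed

lemma (in domain) countable_simple_extension:
  assumes "K \<subseteq> carrier R" "countable K" "x \<in> carrier R"
  shows "countable (simple_extension K x)"
proof -
  have "carrier (K[X]) \<subseteq> lists K"
    by (auto simp: univ_poly_carrier[symmetric] dest!: polynomial_incl)
  then have "countable (carrier (K[X]))"
    by (rule countable_subset[OF _ countable_lists[OF assms(2)]])
  then show ?thesis unfolding simple_extension_as_eval_img[OF assms(1,3)] by simp
qed

lemma (in ideal) a_r_coset_eq_zero_iff:
  assumes "x \<in> carrier R"
  shows "I +> x = \<zero>\<^bsub>R Quot I\<^esub> \<longleftrightarrow> x \<in> I"
  using assms a_rcos_zero[OF is_ideal] rcos_const_imp_mem by (auto simp: FactRing_def)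

lemma (in ideal) rcos_image: "(+>) I ` carrier R = carrier (R Quot I)"
  unfolding FactRing_def A_RCOSETS_def' by auto

text \<open>Indexing by all natural numbers treats finite and countably infinite residue fields
  alike. In the finite case representatives repeat, so comparisons of such enumerations must also
  record which entries are congruent.\<close>

definition (in ring) residue_reps :: "'a set \<Rightarrow> nat \<Rightarrow> 'a" where
  "residue_reps M i = inv_into (carrier R) ((+>) M) (from_nat_into (carrier (R Quot M)) i)"

context domain
begin

lemma free_over_exists:
  assumes "subring K R" "countable K" "A \<subseteq> carrier R" "\<not> countable A"
  shows "\<exists>x\<in>A. x \<noteq> \<zero> \<and> free_over K x"
proof (rule ccontr)
  assume "\<not> ?thesis"
  then have "A \<subseteq> insert \<zero> {x \<in> carrier R. \<not> free_over K x}" using assms(3) by blast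
  then have "countable A"
    by (rule countable_subset) (simp add: countable_not_free[OF assms(1,2)])
  then show False using assms(4) by contradiction
qed

lemma quotient_no_maximal_subring:
  assumes "maximalideal M R" "\<nexists>S. maximal_subring S R"
  shows "\<nexists>S. maximal_subring S (R Quot M)"
proof -
  interpret M: maximalideal M R by fact
  interpret h: ring_hom_ring R "R Quot M" "(+>) M" by (rule M.rcos_ring_hom_ring)
  have "(+>) M ` carrier R = carrier (R Quot M)" using M.rcos_image .
  from h.maximal_subring_vimage[OF this] show ?thesis using assms(2) by blast
qed

text \<open>An uncountable field contains a nonzero element transcendental over a countable subring.
  It is a unit, so the field has a maximal subring, which pulls back to \<open>R\<close>.\<close>

lemma countable_residue_field:
  assumes M: "maximalideal M R" and no: "\<nexists>S. maximal_subring S R"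
  shows "countable (carrier (R Quot M))"
proof (rule ccontr)
  assume unc: "\<not> ?thesis"
  interpret M: maximalideal M R by fact
  interpret Q: field "R Quot M" using M.quotient_is_field[OF is_cring] .
  obtain K where K: "subring K (R Quot M)" "countable K" using Q.countable_subring_exists by blast
  obtain x where "x \<in> carrier (R Quot M)" "x \<noteq> \<zero>\<^bsub>R Quot M\<^esub>" "Q.free_over K x"
    using Q.free_over_exists[OF K subset_refl unc] by blast
  moreover from this have "x \<in> Units (R Quot M)" using Q.field_Units by blast
  ultimately have "\<exists>S. maximal_subring S (R Quot M)"
    using Q.maximal_subring_of_transcendental_unit[OF K(1)] by blast
  then show False using quotient_no_maximal_subring[OF M no] by contradiction
qed

text \<open>If \<open>M\<close> met \<open>K[t]\<close> only in zero, the image of \<open>t\<close>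
  in the residue field would be a unit transcendental over the image of \<open>K\<close>.\<close>

lemma maximalideal_meets_simple_extension:
  assumes M: "maximalideal M R" and no: "\<nexists>S. maximal_subring S R"
    and K: "subring K R" and t: "t \<in> carrier R" "t \<noteq> \<zero>" "free_over K t"
  shows "\<exists>d\<in>simple_extension K t. d \<noteq> \<zero> \<and> d \<in> M"
proof (rule ccontr)
  assume neg: "\<not> ?thesis"
  interpret M: maximalideal M R by fact
  interpret Q: field "R Quot M" using M.quotient_is_field[OF is_cring] .
  interpret h: ring_hom_ring R "R Quot M" "(+>) M" by (rule M.rcos_ring_hom_ring)
  note Kc = subringE(1)[OF K]
  have D: "subring (simple_extension K t) R" using simple_extension_is_subring[OF K t(1)] .
  have tD: "t \<in> simple_extension K t" "K \<subseteq> simple_extension K t"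
    using simple_extension_mem[OF K t(1)] simple_extension_incl[OF Kc t(1)] by auto
  have "M +> t \<noteq> \<zero>\<^bsub>R Quot M\<^esub>" using M.a_r_coset_eq_zero_iff t neg tD by blast
  then have "M +> t \<in> Units (R Quot M)" using Q.field_Units t(1) h.hom_closed by blast
  moreover have "Q.free_over ((+>) M ` K) (M +> t)"
    unfolding Q.free_over_def
  proof (intro ballI impI)
    fix f c assume f: "f \<in> Q.simple_extension ((+>) M ` K) (M +> t)" and c: "c \<in> (+>) M ` K"
      and eq: "f \<otimes>\<^bsub>R Quot M\<^esub> (M +> t) \<oplus>\<^bsub>R Quot M\<^esub> c = \<zero>\<^bsub>R Quot M\<^esub>"
    obtain f' where f': "f' \<in> simple_extension K t" "f = M +> f'"
      using h.simple_extension_image[OF Kc t(1) f] by blast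
    obtain c' where c': "c' \<in> K" "c = M +> c'" using c by blast
    have cc: "f' \<in> carrier R" "c' \<in> carrier R" using f' c' subringE(1)[OF D] Kc by auto
    have e: "f' \<otimes> t \<oplus> c' \<in> simple_extension K t"
      using f'(1) tD c'(1) by (simp add: subringE(6,7)[OF D] subsetD[OF tD(2)])
    have "M +> (f' \<otimes> t \<oplus> c') = \<zero>\<^bsub>R Quot M\<^esub>" using eq f' c' cc t(1) by simp
    moreover have "f' \<otimes> t \<oplus> c' \<in> carrier R" using cc t(1) by simp
    ultimately have "f' \<otimes> t \<oplus> c' \<in> M" using M.a_r_coset_eq_zero_iff by blast
    then have "f' \<otimes> t \<oplus> c' = \<zero>" using neg e by blast
    then have "c' = \<zero>" using free_overD[OF t(3) f'(1) c'(1)] by blast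
    then show "c = \<zero>\<^bsub>R Quot M\<^esub>" using c'(2) h.hom_zero by simp
  qed
  ultimately have "\<exists>S. maximal_subring S (R Quot M)"
    by (rule Q.maximal_subring_of_transcendental_unit[OF h.img_is_subring[OF K]])
  then show False using quotient_no_maximal_subring[OF M no] by contradiction
qed

text \<open>For \<open>a\<close> nonzero the elements \<open>1 + at\<close> are uncountably many, so
  one of them is transcendental over a countable subring. All of them are units, since
  \<open>a\<close> lies in every maximal ideal.\<close>

lemma jacobson_radical_zero:
  assumes no: "\<nexists>S. maximal_subring S R" and unc: "\<not> countable (carrier R)"
    and a: "a \<in> carrier R" "\<And>M. maximalideal M R \<Longrightarrow> a \<in> M"
  shows "a = \<zero>"
proof (rule ccontr)
  assume a0: "a \<noteq> \<zero>"
  obtain K where K: "subring K R" "countable K" using countable_subring_exists by blast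
  let ?u = "\<lambda>t. \<one> \<oplus> a \<otimes> t"
  have inj: "inj_on ?u (carrier R)"
  proof (rule inj_onI)
    fix s t assume s: "s \<in> carrier R" and t: "t \<in> carrier R" and "?u s = ?u t"
    then have "a \<otimes> s = a \<otimes> t" using a(1) by simp
    then show "s = t" using m_lcancel[OF a0 a(1) s t] by blast
  qed
  have "\<not> countable (?u ` carrier R)" using unc countable_image_inj_on[OF _ inj] by blast
  moreover have "?u ` carrier R \<subseteq> carrier R" using a(1) by auto
  ultimately obtain x where x: "x \<in> ?u ` carrier R" "free_over K x"
    using free_over_exists[OF K, of "?u ` carrier R"] by blast
  obtain t where t: "t \<in> carrier R" "x = \<one> \<oplus> a \<otimes> t" using x(1) by blast
  have "x \<in> Units R"
  proof (rule Units_if_no_maximalideal)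
    show "x \<in> carrier R" using t a(1) by simp
    fix M assume M: "maximalideal M R"
    then interpret M: maximalideal M R .
    show "x \<notin> M"
    proof
      assume "x \<in> M"
      moreover have "a \<otimes> t \<in> M" using M.I_r_closed[OF a(2)[OF M] t(1)] .
      ultimately have "x \<oplus> \<ominus> (a \<otimes> t) \<in> M" by simp
      moreover have "x \<oplus> \<ominus> (a \<otimes> t) = \<one>" unfolding t(2) using a(1) t(1) by (simp add: a_assoc r_neg)
      ultimately show False using M.one_imp_carrier M.I_notcarr by simp
    qed
  qed
  from maximal_subring_of_transcendental_unit[OF K(1) this x(2)] show False using no by contradiction
qed

text \<open>Matching tables turn \<open>e i \<mapsto> f i\<close> into an isomorphism of residue
  fields. Composed with the quotient map of \<open>M\<close>, it gives a second surjection
  \<open>h\<close> onto the residue field of \<open>N\<close>. If \<open>M\<close> and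
  \<open>N\<close> differed, the equalizer of \<open>h\<close> and the quotient map of
  \<open>N\<close> would be a maximal subring.\<close>

lemma maximalideal_eq_if_residue_tables_eq:
  fixes e f :: "nat \<Rightarrow> 'a"
  assumes M: "maximalideal M R" and N: "maximalideal N R" and no: "\<nexists>S. maximal_subring S R"
    and e: "range e \<subseteq> carrier R" "(\<lambda>i. M +> e i) ` UNIV = carrier (R Quot M)"
    and f: "range f \<subseteq> carrier R" "(\<lambda>i. N +> f i) ` UNIV = carrier (R Quot N)"
    and eq: "\<And>i j. M +> e i = M +> e j \<longleftrightarrow> N +> f i = N +> f j"
    and add: "\<And>i j k. M +> (e i \<oplus> e j) = M +> e k \<longleftrightarrow> N +> (f i \<oplus> f j) = N +> f k"
    and mult: "\<And>i j k. M +> (e i \<otimes> e j) = M +> e k \<longleftrightarrow> N +> (f i \<otimes> f j) = N +> f k"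
  shows "M = N"
proof (rule ccontr)
  assume "M \<noteq> N"
  interpret M: maximalideal M R by fact
  interpret N: maximalideal N R by fact
  interpret A: field "R Quot N" using N.quotient_is_field[OF is_cring] .
  interpret hM: ring_hom_ring R "R Quot M" "(+>) M" by (rule M.rcos_ring_hom_ring)
  interpret hN: ring_hom_ring R "R Quot N" "(+>) N" by (rule N.rcos_ring_hom_ring)
  have ec: "e i \<in> carrier R" "f i \<in> carrier R" for i using e(1) f(1) by auto
  have exM: "\<exists>i. M +> t = M +> e i" if "t \<in> carrier R" for t
    using hM.hom_closed[OF that] unfolding e(2)[symmetric] by blast
  have exN: "\<exists>i. \<alpha> = N +> f i" if "\<alpha> \<in> carrier (R Quot N)" for \<alpha>
    using that unfolding f(2)[symmetric] by blast
  define ind where "ind t = (SOME i. M +> t = M +> e i)" for t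
  have ind: "M +> t = M +> e (ind t)" if "t \<in> carrier R" for t
    unfolding ind_def using someI_ex[OF exM[OF that]] .
  define h where "h t = N +> f (ind t)" for t
  have h_eq: "h t = N +> f i" if "t \<in> carrier R" "M +> t = M +> e i" for t i
    unfolding h_def using eq ind[OF that(1)] that(2) by simp
  have h_closed: "h t \<in> carrier (R Quot N)" for t unfolding h_def using ec by simp
  have h_add: "h (s \<oplus> t) = h s \<oplus>\<^bsub>R Quot N\<^esub> h t" if s: "s \<in> carrier R" and t: "t \<in> carrier R" for s t
  proof -
    obtain k where k: "M +> (s \<oplus> t) = M +> e k" using exM s t by blast
    then have "M +> (e (ind s) \<oplus> e (ind t)) = M +> e k"
      using ind[OF s] ind[OF t] s t ec by simp
    then have "N +> (f (ind s) \<oplus> f (ind t)) = N +> f k" using add by blast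
    then show ?thesis using h_eq[OF _ k] s t ec unfolding h_def[of s] h_def[of t] by simp
  qed
  have h_mult: "h (s \<otimes> t) = h s \<otimes>\<^bsub>R Quot N\<^esub> h t" if s: "s \<in> carrier R" and t: "t \<in> carrier R" for s t
  proof -
    obtain k where k: "M +> (s \<otimes> t) = M +> e k" using exM s t by blast
    then have "M +> (e (ind s) \<otimes> e (ind t)) = M +> e k"
      using ind[OF s] ind[OF t] s t ec by simp
    then have "N +> (f (ind s) \<otimes> f (ind t)) = N +> f k" using mult by blast
    then show ?thesis using h_eq[OF _ k] s t ec unfolding h_def[of s] h_def[of t] by simp
  qed
  have h_surj: "h ` carrier R = carrier (R Quot N)"
  proof
    show "carrier (R Quot N) \<subseteq> h ` carrier R"
    proof
      fix \<alpha> assume "\<alpha> \<in> carrier (R Quot N)"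
      then obtain i where "\<alpha> = N +> f i" using exN by blast
      then show "\<alpha> \<in> h ` carrier R" using h_eq[OF ec(1) refl, of i] ec by blast
    qed
  qed (use h_closed in blast)
  \<comment> \<open>The tables do not mark the unit; it is recovered by multiplying with a preimage
    of one.\<close>
  have h_one: "h \<one> = \<one>\<^bsub>R Quot N\<^esub>"
  proof -
    obtain t where t: "t \<in> carrier R" "h t = \<one>\<^bsub>R Quot N\<^esub>" using h_surj A.one_closed by (metis imageE)
    have "h (\<one> \<otimes> t) = h \<one> \<otimes>\<^bsub>R Quot N\<^esub> h t" using h_mult[OF one_closed t(1)] .
    then show ?thesis using t h_closed[of \<one>] by simp
  qed
  have h_hom: "h \<in> ring_hom R (R Quot N)"
    by (rule ring_hom_memI) (use h_closed h_add h_mult h_one in auto)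
  interpret h: ring_hom_ring R "R Quot N" h
    by (rule ring_hom_ringI2[OF ring_axioms A.ring_axioms h_hom])
  have "\<not> M \<subseteq> N"
    using N.I_notcarr M.I_maximal[OF N.is_ideal _ N.a_subset] \<open>M \<noteq> N\<close> by blast
  then obtain a where a: "a \<in> M" "a \<notin> N" by blast
  have ac: "a \<in> carrier R" using a(1) M.Icarr by blast
  have "M +> a = M +> \<zero>"
    using M.a_r_coset_eq_zero_iff[OF ac] M.a_r_coset_eq_zero_iff[OF zero_closed] a(1) M.zero_closed by simp
  then have "h a = h \<zero>" using h_eq[OF ac] ind[OF zero_closed] unfolding h_def[of \<zero>] by simp
  then have "h a = \<zero>\<^bsub>R Quot N\<^esub>" by simp
  moreover have "N +> a \<noteq> \<zero>\<^bsub>R Quot N\<^esub>" using N.a_r_coset_eq_zero_iff[OF ac] a(2) by blast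
  moreover have "(+>) N ` carrier R = carrier (R Quot N)" using N.rcos_image .
  ultimately have "maximal_subring {t \<in> carrier R. h t = N +> t} R"
    using maximal_subring_equalizer[OF is_cring A.field_axioms h_hom h_surj N.rcos_ring_hom _ ac] by simp
  then show False using no by blast
qed

lemma residue_reps:
  assumes "maximalideal M R" "\<nexists>S. maximal_subring S R"
  shows "range (residue_reps M) \<subseteq> carrier R"
    and "(\<lambda>i. M +> residue_reps M i) ` UNIV = carrier (R Quot M)"
proof -
  interpret M: maximalideal M R by fact
  interpret h: ring_hom_ring R "R Quot M" "(+>) M" by (rule M.rcos_ring_hom_ring)
  have img: "(+>) M ` carrier R = carrier (R Quot M)" using M.rcos_image .
  have ne: "carrier (R Quot M) \<noteq> {}" using h.hom_closed[OF zero_closed] by blast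
  let ?c = "from_nat_into (carrier (R Quot M))"
  have mem: "?c i \<in> (+>) M ` carrier R" for i unfolding img using from_nat_into[OF ne] .
  have e: "residue_reps M i \<in> carrier R" "M +> residue_reps M i = ?c i" for i
    unfolding residue_reps_def by (rule inv_into_into[OF mem], rule f_inv_into_f[OF mem])
  show "range (residue_reps M) \<subseteq> carrier R" using e(1) by blast
  show "(\<lambda>i. M +> residue_reps M i) ` UNIV = carrier (R Quot M)"
    unfolding e(2) by (rule range_from_nat_into[OF ne countable_residue_field[OF assms]])
qed

text \<open>A maximal ideal is determined by the tables of its enumerated residue field, and these
  fit into one set of natural numbers.\<close>

lemma maximalideals_lepoll:
  assumes no: "\<nexists>S. maximal_subring S R"
  shows "{M. maximalideal M R} \<lesssim> (UNIV :: nat set set)"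
proof -
  let ?e = residue_reps
  \<comment> \<open>The tag \<open>b\<close> separates congruence, sum and product; for congruence
    the last index is free.\<close>
  define table :: "'a set \<Rightarrow> (nat \<times> nat \<times> nat \<times> nat) set" where
    "table M = {(b, i, j, k). (b = 0 \<and> M +> ?e M i = M +> ?e M j) \<or>
       (b = 1 \<and> M +> (?e M i \<oplus> ?e M j) = M +> ?e M k) \<or>
       (b = 2 \<and> M +> (?e M i \<otimes> ?e M j) = M +> ?e M k)}" for M
  have "inj_on (\<lambda>M. to_nat ` table M) {M. maximalideal M R}"
  proof (rule inj_onI)
    fix M N assume "M \<in> {M. maximalideal M R}" "N \<in> {M. maximalideal M R}"
      and im: "to_nat ` table M = to_nat ` table N"
    then have M: "maximalideal M R" and N: "maximalideal N R" by simp_all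
    have tab: "q \<in> table M \<longleftrightarrow> q \<in> table N" for q
      using im unfolding inj_image_eq_iff[OF inj_to_nat] by simp
    have eq: "M +> ?e M i = M +> ?e M j \<longleftrightarrow> N +> ?e N i = N +> ?e N j" for i j
      using tab[of "(0, i, j, 0)"] by (simp add: table_def)
    have add: "M +> (?e M i \<oplus> ?e M j) = M +> ?e M k \<longleftrightarrow> N +> (?e N i \<oplus> ?e N j) = N +> ?e N k" for i j k
      using tab[of "(1, i, j, k)"] by (simp add: table_def)
    have mult: "M +> (?e M i \<otimes> ?e M j) = M +> ?e M k \<longleftrightarrow> N +> (?e N i \<otimes> ?e N j) = N +> ?e N k" for i j k
      using tab[of "(2, i, j, k)"] by (simp add: table_def)
    show "M = N"
      by (rule maximalideal_eq_if_residue_tables_eq[OF M N no residue_reps[OF M no]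
            residue_reps[OF N no]
            eq add mult])
  qed
  then show ?thesis unfolding lepoll_def by blast
qed

end

section \<open>Counting residue classes in dimension zero\<close>

lemma lepoll_nat_set_fun: "(UNIV :: (nat \<Rightarrow> nat set) set) \<lesssim> (UNIV :: nat set set)"
proof -
  have "inj (\<lambda>f :: nat \<Rightarrow> nat set. {prod_encode (i, n) | i n. n \<in> f i})"
  proof (rule injI, rule ext)
    fix f g :: "nat \<Rightarrow> nat set" and i
    assume eq: "{prod_encode (i, n) | i n. n \<in> f i} = {prod_encode (i, n) | i n. n \<in> g i}"
    have "n \<in> h i \<longleftrightarrow> prod_encode (i, n) \<in> {prod_encode (i, n) | i n. n \<in> h i}" for h :: "nat \<Rightarrow> nat set" and n
      by auto
    then show "f i = g i" using eq by blast
  qed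
  then show ?thesis unfolding lepoll_def by blast
qed

lemma lists_lepoll_nat_set:
  assumes "A \<lesssim> (UNIV :: nat set set)"
  shows "lists A \<lesssim> (UNIV :: nat set set)"
proof -
  obtain f :: "'a \<Rightarrow> nat set" where f: "inj_on f A" using assms unfolding lepoll_def by blast
  \<comment> \<open>Index 0 stores the length, so the entries are shifted by one and the default
    \<open>{}\<close> cannot be confused with an entry.\<close>
  define g :: "'a list \<Rightarrow> nat \<Rightarrow> nat set" where
    "g xs i = (if i = 0 then {length xs} else if i - 1 < length xs then f (xs ! (i - 1)) else {})" for xs i
  have "inj_on g (lists A)"
  proof (rule inj_onI)
    fix xs ys assume xs: "xs \<in> lists A" and ys: "ys \<in> lists A" and eq: "g xs = g ys"
    have len: "length xs = length ys" using fun_cong[OF eq, of 0] by (simp add: g_def)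
    show "xs = ys"
    proof (rule nth_equalityI[OF len])
      fix i assume i: "i < length xs"
      then have "f (xs ! i) = f (ys ! i)" using fun_cong[OF eq, of "Suc i"] len by (simp add: g_def)
      moreover have "xs ! i \<in> A" "ys ! i \<in> A" using xs ys i len by (auto simp: in_lists_conv_set)
      ultimately show "xs ! i = ys ! i" using f by (simp add: inj_on_eq_iff)
    qed
  qed
  then have "lists A \<lesssim> (UNIV :: (nat \<Rightarrow> nat set) set)" unfolding lepoll_def by blast
  then show ?thesis by (rule lepoll_trans[OF _ lepoll_nat_set_fun])
qed

lemma times_lepoll_nat_set:
  assumes "A \<lesssim> (UNIV :: nat set set)" "B \<lesssim> (UNIV :: nat set set)"
  shows "A \<times> B \<lesssim> (UNIV :: nat set set)"
proof -
  obtain f :: "'a \<Rightarrow> nat set" where f: "inj_on f A" using assms unfolding lepoll_def by blast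
  obtain g :: "'b \<Rightarrow> nat set" where g: "inj_on g B" using assms unfolding lepoll_def by blast
  define h :: "'a \<times> 'b \<Rightarrow> nat \<Rightarrow> nat set" where
    "h p i = (if i = 0 then f (fst p) else g (snd p))" for p i
  have "inj_on h (A \<times> B)"
  proof (rule inj_onI)
    fix p q assume pq: "p \<in> A \<times> B" "q \<in> A \<times> B" and eq: "h p = h q"
    have "f (fst p) = f (fst q)" "g (snd p) = g (snd q)"
      using fun_cong[OF eq, of 0] fun_cong[OF eq, of 1] by (simp_all add: h_def)
    then show "p = q" using inj_onD[OF f] inj_onD[OF g] pq by (auto simp: prod_eq_iff mem_Times_iff)
  qed
  then have "A \<times> B \<lesssim> (UNIV :: (nat \<Rightarrow> nat set) set)" unfolding lepoll_def by blast
  then show ?thesis by (rule lepoll_trans[OF _ lepoll_nat_set_fun])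
qed

section \<open>Coding elements modulo an intersection of maximal ideals\<close>

context cring
begin

lemma idealI_cring:
  assumes "I \<subseteq> carrier R" "\<zero> \<in> I"
    and add: "\<And>a b. a \<in> I \<Longrightarrow> b \<in> I \<Longrightarrow> a \<oplus> b \<in> I"
    and mult: "\<And>r a. r \<in> carrier R \<Longrightarrow> a \<in> I \<Longrightarrow> r \<otimes> a \<in> I"
  shows "ideal I R"
proof (rule idealI[OF ring_axioms])
  show "subgroup I (add_monoid R)"
  proof (rule add.subgroupI)
    fix a assume a: "a \<in> I"
    then have "(\<ominus> \<one>) \<otimes> a \<in> I" using mult[of "\<ominus> \<one>" a] by simp
    then show "\<ominus> a \<in> I" using a assms(1) by (simp add: l_minus subset_iff)
  qed (use assms in auto)
  fix a x assume a: "a \<in> I" and x: "x \<in> carrier R"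
  then show "x \<otimes> a \<in> I" using mult by blast
  then show "a \<otimes> x \<in> I" using m_comm[OF x] a assms(1) by auto
qed

lemma one_mem_ideal_if_in_no_maximalideal:
  assumes "ideal L R" and "\<And>M. maximalideal M R \<Longrightarrow> L \<subseteq> M \<Longrightarrow> False"
  shows "\<one> \<in> L"
  using maximalideal_exists[OF assms(1)] assms(2) one_closed by metis

text \<open>
  If \<open>V\<close> is the closed set of maximal ideals containing its intersection \<open>N\<close>, then \<open>sep\<close> says that
  \<open>R/N\<close> is von Neumann regular. Near \<open>M\<close> an element agrees with a representative \<open>e M i\<close>, and the
  neighbourhood can be taken of the form \<open>g \<notin> M\<close>, with \<open>g\<close> a product of finitely many of the fixed
  elements \<open>s M M'\<close> separating \<open>M\<close> from \<open>M'\<close>. By compactness finitely many such pairs determine the element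
  modulo \<open>N\<close>.
\<close>

lemma code_modulo_intersection_of_maximalideals:
  fixes V :: "'a set set" and e :: "'a set \<Rightarrow> nat \<Rightarrow> 'a"
  defines "N \<equiv> {z \<in> carrier R. \<forall>M\<in>V. z \<in> M}"
  assumes V: "\<And>M. M \<in> V \<Longrightarrow> maximalideal M R"
    and closed: "\<And>M. maximalideal M R \<Longrightarrow> N \<subseteq> M \<Longrightarrow> M \<in> V"
    and sep: "\<And>M v. M \<in> V \<Longrightarrow> v \<in> M \<Longrightarrow> \<exists>s\<in>carrier R - M. s \<otimes> v \<in> N"
    and card: "V \<lesssim> (UNIV :: nat set set)"
    and e: "\<And>M i. M \<in> V \<Longrightarrow> e M i \<in> carrier R"
      "\<And>M t. M \<in> V \<Longrightarrow> t \<in> carrier R \<Longrightarrow> \<exists>i. t \<ominus> e M i \<in> M"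
  shows "\<exists>\<psi> :: 'a \<Rightarrow> nat set. \<forall>t\<in>carrier R. \<forall>t'\<in>carrier R. \<psi> t = \<psi> t' \<longrightarrow> t \<ominus> t' \<in> N"
proof -
  have Vid: "ideal M R" if "M \<in> V" for M using V[OF that] maximalideal.axioms(1) by blast
  have Vprime: "primeideal M R" if "M \<in> V" for M using maximalideal_prime[OF V[OF that]] .
  interpret N: ideal N R
  proof (rule idealI_cring)
    show "N \<subseteq> carrier R" unfolding N_def by blast
    show "\<zero> \<in> N" unfolding N_def using additive_subgroup.zero_closed[OF ideal.axioms(1)[OF Vid]] by simp
    show "a \<oplus> b \<in> N" if "a \<in> N" "b \<in> N" for a b
      using that additive_subgroup.a_closed[OF ideal.axioms(1)[OF Vid]] unfolding N_def by simp
    show "r \<otimes> a \<in> N" if "r \<in> carrier R" "a \<in> N" for r a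
      using that ideal.I_l_closed[OF Vid] unfolding N_def by simp
  qed
  \<comment> \<open>Such an \<open>s\<close> is nonzero at \<open>M\<close> and vanishes near
    \<open>M'\<close>: it is annihilated modulo \<open>N\<close> by some \<open>u\<close> outside
    \<open>M'\<close>.\<close>
  define sp where "sp M M' s \<longleftrightarrow> s \<in> carrier R - M \<and> (\<exists>u\<in>carrier R - M'. s \<otimes> u \<in> N)" for M M' s
  define s where "s M M' = (SOME s. sp M M' s)" for M M'
  have s: "sp M M' (s M M')" if M: "M \<in> V" "M' \<in> V" "M \<noteq> M'" for M M'
  proof -
    have "\<not> M \<subseteq> M'"
      using maximalideal.I_maximal[OF V[OF M(1)] Vid[OF M(2)]] maximalideal.I_notcarr[OF V[OF M(2)]]
        M(3) additive_subgroup.a_subset[OF ideal.axioms(1)[OF Vid[OF M(2)]]] by blast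
    then obtain u where u: "u \<in> M" "u \<notin> M'" by blast
    obtain s' where "s' \<in> carrier R - M" "s' \<otimes> u \<in> N" using sep[OF M(1) u(1)] by blast
    then have "sp M M' s'" unfolding sp_def using u ideal.Icarr[OF Vid[OF M(1)] u(1)] by blast
    then show ?thesis unfolding s_def by (rule someI[of "sp M M'"])
  qed
  define prd where "prd M l = foldr (\<lambda>M' g. s M M' \<otimes> g) l \<one>" for M l
  have prd_simps: "prd M [] = \<one>" "prd M (M' # l) = s M M' \<otimes> prd M l" for M M' l
    unfolding prd_def by simp_all
  have prd: "prd M l \<in> carrier R" if "M \<in> V" "l \<in> lists (V - {M})" for M l
    using that(2)
  proof (induction l)
    case (Cons M' l)
    then have "sp M M' (s M M')" using s[OF that(1), of M'] by auto
    then have "s M M' \<in> carrier R" unfolding sp_def by blast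
    then show ?case using Cons unfolding prd_simps by simp
  qed (simp add: prd_simps)
  have prd_notin: "prd M l \<notin> M" if "M \<in> V" "l \<in> lists (V - {M})" for M l
    using that(2)
  proof (induction l)
    case Nil
    then show ?case
      using ideal.one_imp_carrier[OF Vid[OF that(1)]] maximalideal.I_notcarr[OF V[OF that(1)]]
      unfolding prd_simps by blast
  next
    case (Cons M' l)
    then have "sp M M' (s M M')" using s[OF that(1), of M'] by auto
    then have "s M M' \<in> carrier R" "s M M' \<notin> M" unfolding sp_def by blast+
    then show ?case
      using Cons prd[OF that(1), of l] primeideal.I_prime[OF Vprime[OF that(1)]] unfolding prd_simps by auto
  qed
  have prd_append: "prd M (l @ l') = prd M l \<otimes> prd M l'"
    if M: "M \<in> V" and l: "l \<in> lists (V - {M})" "l' \<in> lists (V - {M})" for M l l'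
    using l(1)
  proof (induction l)
    case Nil
    then show ?case using prd[OF M l(2)] unfolding prd_simps by simp
  next
    case (Cons M' l)
    then have "sp M M' (s M M')" using s[OF M, of M'] by auto
    then have "s M M' \<in> carrier R" unfolding sp_def by blast
    then show ?case using Cons prd[OF M] l(2) unfolding prd_simps append_Cons by (simp add: m_assoc)
  qed
  \<comment> \<open>The multipliers supplied by \<open>sep\<close> are arbitrary elements and cannot
    be counted; those used here are determined by a list of ideals. The multipliers \<open>z\<close>
    that suffice together with some \<open>prd M l\<close> form an ideal \<open>L\<close>. A maximal
    ideal over \<open>L\<close> would belong to \<open>V\<close>, but \<open>sep\<close> excludes
    \<open>M\<close> and the separating element \<open>s M M'\<close> excludes any other
    \<open>M'\<close>.\<close>
  have local_eq: "\<exists>l\<in>lists (V - {M}). prd M l \<otimes> v \<in> N" if M: "M \<in> V" and v: "v \<in> M" for M v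
  proof -
    have vc: "v \<in> carrier R" using ideal.Icarr[OF Vid[OF M] v] .
    define L where "L = {z \<in> carrier R. \<exists>l\<in>lists (V - {M}). prd M l \<otimes> z \<otimes> v \<in> N}"
    have LI: "z \<in> L" if "z \<in> carrier R" "l \<in> lists (V - {M})" "prd M l \<otimes> z \<otimes> v \<in> N" for z l
      using that unfolding L_def by blast
    have LE: "\<exists>l\<in>lists (V - {M}). prd M l \<otimes> z \<otimes> v \<in> N" "z \<in> carrier R" if "z \<in> L" for z
      using that unfolding L_def by simp_all
    have memL: "z \<in> L" if "z \<in> carrier R" "z \<otimes> v \<in> N" for z
    proof -
      have "prd M [] \<otimes> z \<otimes> v \<in> N" unfolding prd_simps using that by simp
      then show ?thesis by (rule LI[OF that(1) lists.Nil])
    qed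
    have "ideal L R"
    proof (rule idealI_cring)
      show "\<zero> \<in> L" using memL[of \<zero>] vc N.zero_closed by simp
    next
      fix a b assume a: "a \<in> L" and b: "b \<in> L"
      obtain l where l: "a \<in> carrier R" "l \<in> lists (V - {M})" "prd M l \<otimes> a \<otimes> v \<in> N"
        using LE[OF a] by blast
      obtain l' where l': "b \<in> carrier R" "l' \<in> lists (V - {M})" "prd M l' \<otimes> b \<otimes> v \<in> N"
        using LE[OF b] by blast
      have c: "prd M l \<in> carrier R" "prd M l' \<in> carrier R" using prd[OF M] l l' by auto
      have "prd M (l @ l') \<otimes> (a \<oplus> b) \<otimes> v =
          prd M l' \<otimes> (prd M l \<otimes> a \<otimes> v) \<oplus> prd M l \<otimes> (prd M l' \<otimes> b \<otimes> v)"
        unfolding prd_append[OF M l(2) l'(2)] using c l(1) l'(1) vc by algebra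
      also have "\<dots> \<in> N" using l(3) l'(3) c by (simp add: N.a_closed N.I_l_closed)
      finally have "prd M (l @ l') \<otimes> (a \<oplus> b) \<otimes> v \<in> N" .
      moreover have "l @ l' \<in> lists (V - {M})" using l(2) l'(2) by simp
      ultimately show "a \<oplus> b \<in> L" using LI[of "a \<oplus> b" "l @ l'"] l(1) l'(1) by blast
    next
      fix r a assume r: "r \<in> carrier R" and a: "a \<in> L"
      obtain l where l: "a \<in> carrier R" "l \<in> lists (V - {M})" "prd M l \<otimes> a \<otimes> v \<in> N"
        using LE[OF a] by blast
      have "prd M l \<otimes> (r \<otimes> a) \<otimes> v = r \<otimes> (prd M l \<otimes> a \<otimes> v)"
        using prd[OF M l(2)] l(1) r vc by (simp add: m_ac)
      then have "prd M l \<otimes> (r \<otimes> a) \<otimes> v \<in> N" using N.I_l_closed[OF l(3) r] by simp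
      then show "r \<otimes> a \<in> L" using LI[OF _ l(2)] l(1) r by simp
    qed (use LE(2) in blast)
    moreover have False if M': "maximalideal M' R" "L \<subseteq> M'" for M'
    proof -
      have "N \<subseteq> L"
      proof
        fix z assume z: "z \<in> N"
        show "z \<in> L" by (rule memL[OF N.Icarr[OF z] N.I_r_closed[OF z vc]])
      qed
      then have M'V: "M' \<in> V" using closed[OF M'(1) subset_trans[OF _ M'(2)]] by blast
      show False
      proof (cases "M' = M")
        case True
        obtain s0 where "s0 \<in> carrier R - M" "s0 \<otimes> v \<in> N" using sep[OF M v] by blast
        then have "s0 \<in> L" "s0 \<notin> M" using memL[of s0] by simp_all
        then show False using M'(2) True by blast
      next
        case False
        then have "sp M M' (s M M')" using s[OF M M'V] by blast
        then obtain u where u: "s M M' \<in> carrier R" "u \<in> carrier R" "u \<notin> M'" "s M M' \<otimes> u \<in> N"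
          unfolding sp_def by blast
        have "[M'] \<in> lists (V - {M})" using M'V False by simp
        moreover have "prd M [M'] \<otimes> u \<otimes> v \<in> N"
          unfolding prd_simps using u vc N.I_r_closed[OF u(4) vc] by simp
        ultimately have "u \<in> L" using LI u(2) by blast
        then show False using M'(2) u(3) by blast
      qed
    qed
    ultimately have "\<one> \<in> L" by (rule one_mem_ideal_if_in_no_maximalideal)
    then obtain l where l: "l \<in> lists (V - {M})" "prd M l \<otimes> \<one> \<otimes> v \<in> N" using LE(1) by blast
    then show ?thesis using prd[OF M l(1)] by (intro bexI[of _ l]) simp_all
  qed
  \<comment> \<open>A triple encodes a local description: \<open>r p\<close> is the proposed value,
    and \<open>g p\<close> is nonzero on the neighbourhood of \<open>M\<close> where it is
    claimed.\<close>
  define T where "T = {(M, l, i :: nat) | M l i. M \<in> V \<and> l \<in> lists (V - {M})}"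
  define g where "g = (\<lambda>(M, l, i :: nat). prd M l)"
  define r where "r = (\<lambda>(M, l :: 'a set list, i). e M i)"
  have Tc: "g p \<in> carrier R" "r p \<in> carrier R" if "p \<in> T" for p
    using that prd e(1) unfolding T_def g_def r_def by auto
  \<comment> \<open>The last condition expresses that the neighbourhoods cover \<open>V\<close>. Two
    elements with a common good list have a difference killed by every \<open>g p\<close> modulo
    \<open>N\<close>, so the difference is in \<open>N\<close>.\<close>
  define good where "good t L \<longleftrightarrow> L \<in> lists T \<and> (\<forall>p\<in>set L. g p \<otimes> (t \<ominus> r p) \<in> N) \<and>
    (\<forall>v\<in>carrier R. (\<forall>p\<in>set L. g p \<otimes> v \<in> N) \<longrightarrow> v \<in> N)" for t L
  have ex_good: "\<exists>L. good t L" if t: "t \<in> carrier R" for t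
  proof -
    define W where "W = {p \<in> T. g p \<otimes> (t \<ominus> r p) \<in> N}"
    \<comment> \<open>Compactness in terms of ideals: \<open>J\<close> contains \<open>N\<close> and
      all \<open>g p\<close> with \<open>p\<close> in \<open>W\<close>, so no maximal ideal contains
      it. Then \<open>\<one>\<close> lies in \<open>J\<close>, which supplies a finite covering
      list.\<close>
    define J where "J = {z \<in> carrier R. \<exists>L\<in>lists W.
      \<forall>v\<in>carrier R. (\<forall>p\<in>set L. g p \<otimes> v \<in> N) \<longrightarrow> z \<otimes> v \<in> N}"
    have JI: "z \<in> J" if "z \<in> carrier R" "L \<in> lists W"
        "\<And>v. v \<in> carrier R \<Longrightarrow> \<forall>p\<in>set L. g p \<otimes> v \<in> N \<Longrightarrow> z \<otimes> v \<in> N" for z L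
      using that unfolding J_def by blast
    have JE: "\<exists>L\<in>lists W. \<forall>v\<in>carrier R. (\<forall>p\<in>set L. g p \<otimes> v \<in> N) \<longrightarrow> z \<otimes> v \<in> N"
      "z \<in> carrier R" if "z \<in> J" for z using that unfolding J_def by simp_all
    have memL: "g p \<in> J" if p: "p \<in> W" for p
    proof -
      have "[p] \<in> lists W" "g p \<in> carrier R" using p Tc unfolding W_def by auto
      then show ?thesis by (intro JI[of _ "[p]"]) simp_all
    qed
    have NL: "N \<subseteq> J"
    proof
      fix z assume z: "z \<in> N"
      show "z \<in> J" by (rule JI[OF N.Icarr[OF z] lists.Nil]) (rule N.I_r_closed[OF z])
    qed
    have "ideal J R"
    proof (rule idealI_cring)
      show "\<zero> \<in> J" using NL N.zero_closed by blast
    next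
      fix a b assume a: "a \<in> J" and b: "b \<in> J"
      obtain l where l: "a \<in> carrier R" "l \<in> lists W"
        "\<And>v. v \<in> carrier R \<Longrightarrow> \<forall>p\<in>set l. g p \<otimes> v \<in> N \<Longrightarrow> a \<otimes> v \<in> N"
        using JE[OF a] by blast
      obtain l' where l': "b \<in> carrier R" "l' \<in> lists W"
        "\<And>v. v \<in> carrier R \<Longrightarrow> \<forall>p\<in>set l'. g p \<otimes> v \<in> N \<Longrightarrow> b \<otimes> v \<in> N"
        using JE[OF b] by blast
      have "(a \<oplus> b) \<otimes> v \<in> N" if "v \<in> carrier R" "\<forall>p\<in>set (l @ l'). g p \<otimes> v \<in> N" for v
        using l(3)[OF that(1)] l'(3)[OF that(1)] that l(1) l'(1) by (simp add: l_distr N.a_closed)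
      moreover have "l @ l' \<in> lists W" using l(2) l'(2) by simp
      ultimately show "a \<oplus> b \<in> J" using JI[of "a \<oplus> b" "l @ l'"] l(1) l'(1) by blast
    next
      fix c a assume c: "c \<in> carrier R" and a: "a \<in> J"
      obtain l where l: "a \<in> carrier R" "l \<in> lists W"
        "\<And>v. v \<in> carrier R \<Longrightarrow> \<forall>p\<in>set l. g p \<otimes> v \<in> N \<Longrightarrow> a \<otimes> v \<in> N"
        using JE[OF a] by blast
      have "(c \<otimes> a) \<otimes> v \<in> N" if "v \<in> carrier R" "\<forall>p\<in>set l. g p \<otimes> v \<in> N" for v
        using N.I_l_closed[OF l(3)[OF that] c] c l(1) that(1) by (simp add: m_assoc)
      then show "c \<otimes> a \<in> J" using JI[of "c \<otimes> a" l] l(1,2) c by blast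
    qed (use JE(2) in blast)
    moreover have False if M: "maximalideal M R" "J \<subseteq> M" for M
    proof -
      have MV: "M \<in> V" using closed[OF M(1) subset_trans[OF NL M(2)]] .
      obtain i where i: "t \<ominus> e M i \<in> M" using e(2)[OF MV t] by blast
      obtain l where l: "l \<in> lists (V - {M})" "prd M l \<otimes> (t \<ominus> e M i) \<in> N" using local_eq[OF MV i] by blast
      have "(M, l, i) \<in> W" unfolding W_def T_def g_def r_def using MV l by simp
      then have "prd M l \<in> J" using memL[of "(M, l, i)"] by (simp add: g_def)
      then show False using M(2) prd_notin[OF MV l(1)] by blast
    qed
    ultimately have "\<one> \<in> J" by (rule one_mem_ideal_if_in_no_maximalideal)
    then obtain L where L: "L \<in> lists W" "\<forall>v\<in>carrier R. (\<forall>p\<in>set L. g p \<otimes> v \<in> N) \<longrightarrow> \<one> \<otimes> v \<in> N"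
      using JE(1) by blast
    have "good t L"
      unfolding good_def using L by (auto simp: W_def in_lists_conv_set)
    then show ?thesis ..
  qed
  define Lt where "Lt t = (SOME L. good t L)" for t
  have Lt: "good t (Lt t)" if "t \<in> carrier R" for t
    unfolding Lt_def using someI_ex[OF ex_good[OF that]] .
  have "T \<subseteq> V \<times> (lists V \<times> UNIV)" unfolding T_def by (auto simp: in_lists_conv_set)
  moreover have "V \<times> (lists V \<times> (UNIV :: nat set)) \<lesssim> (UNIV :: nat set set)"
  proof (intro times_lepoll_nat_set lists_lepoll_nat_set card)
    show "(UNIV :: nat set) \<lesssim> (UNIV :: nat set set)"
      unfolding lepoll_def by (rule exI[of _ "\<lambda>n. {n}"]) simp
  qed
  ultimately have "T \<lesssim> (UNIV :: nat set set)" by (rule lepoll_trans[OF subset_imp_lepoll])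
  from lists_lepoll_nat_set[OF this]
  obtain j :: "('a set \<times> 'a set list \<times> nat) list \<Rightarrow> nat set" where j: "inj_on j (lists T)"
    unfolding lepoll_def by blast
  show ?thesis
  proof (intro exI[of _ "\<lambda>t. j (Lt t)"] ballI impI)
    fix t t' assume t: "t \<in> carrier R" "t' \<in> carrier R" and eq: "j (Lt t) = j (Lt t')"
    have "Lt t \<in> lists T" "Lt t' \<in> lists T"
      using Lt[OF t(1)] Lt[OF t(2)] unfolding good_def by blast+
    from inj_onD[OF j eq this] have "Lt t = Lt t'" .
    then have good: "good t (Lt t)" "good t' (Lt t)" using Lt[OF t(1)] Lt[OF t(2)] by simp_all
    have "g p \<otimes> (t \<ominus> t') \<in> N" if p: "p \<in> set (Lt t)" for p
    proof -
      have "p \<in> T" using good(1) p unfolding good_def by (auto simp: in_lists_conv_set)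
      note c = Tc[OF this]
      have a: "g p \<otimes> (t \<ominus> r p) \<in> N" "g p \<otimes> (t' \<ominus> r p) \<in> N" using good p unfolding good_def by blast+
      have "g p \<otimes> (t \<ominus> t') = g p \<otimes> (t \<ominus> r p) \<oplus> (\<ominus> \<one>) \<otimes> (g p \<otimes> (t' \<ominus> r p))"
        using c t by algebra
      moreover have "\<dots> \<in> N" using a by (simp add: N.a_closed N.I_l_closed)
      ultimately show ?thesis by simp
    qed
    then show "t \<ominus> t' \<in> N" using good(1) minus_closed[OF t] unfolding good_def by blast
  qed
qed

end

section \<open>Cardinality of one-dimensional domains without maximal subrings\<close>

text \<open>If no product \<open>s v^n\<close> with \<open>s\<close> outside \<open>M\<close> lay in
  \<open>(d)\<close>, a prime over \<open>(d)\<close> avoiding these products would be maximal and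
  contained in \<open>M\<close>, hence equal to \<open>M\<close>, yet it avoids \<open>v\<close>. So
  some \<open>s v^n\<close> lies in \<open>(d)\<close>, and primality puts \<open>s v\<close> into
  each maximal ideal containing \<open>d\<close>.\<close>

lemma (in domain) krull_dim_1_multiplier:
  assumes dim: "krull_dim R = 1" and dc: "d \<in> carrier R" "d \<noteq> \<zero>"
    and M: "maximalideal M R" and v: "v \<in> M"
  shows "\<exists>s\<in>carrier R - M. \<forall>M'. maximalideal M' R \<and> d \<in> M' \<longrightarrow> s \<otimes> v \<in> M'"
proof -
  interpret M: maximalideal M R by (rule M)
  interpret Mp: primeideal M R using maximalideal_prime[OF M.is_maximalideal] .
  have vc: "v \<in> carrier R" using M.Icarr[OF v] .
  define S where "S = {s \<otimes> v [^] n | s (n::nat). s \<in> carrier R - M}"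
  have SI: "s \<otimes> v [^] n \<in> S" if "s \<in> carrier R" "s \<notin> M" for s and n :: nat
    using that unfolding S_def by blast
  have SE: "\<exists>s n. x = s \<otimes> v [^] (n::nat) \<and> s \<in> carrier R \<and> s \<notin> M" if "x \<in> S" for x
    using that unfolding S_def by blast
  have one: "\<one> \<notin> M" using M.one_imp_carrier M.I_notcarr by auto
  have "PIdl d \<inter> S \<noteq> {}"
  proof
    assume disj: "PIdl d \<inter> S = {}"
    obtain Q where Q: "primeideal Q R" "PIdl d \<subseteq> Q" "Q \<inter> S = {}"
    proof (rule primeideal_disjoint_exists[OF cgenideal_ideal[OF dc(1)] disj])
      show "S \<subseteq> carrier R" using vc unfolding S_def by auto
      show "\<one> \<in> S" using SI[OF one_closed one, of 0] by simp
      fix x y assume xS: "x \<in> S" and yS: "y \<in> S"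
      obtain s and n :: nat where x: "x = s \<otimes> v [^] n" "s \<in> carrier R" "s \<notin> M" using SE[OF xS] by blast
      obtain s' and n' :: nat where y: "y = s' \<otimes> v [^] n'" "s' \<in> carrier R" "s' \<notin> M"
        using SE[OF yS] by blast
      have "x \<otimes> y = (s \<otimes> s') \<otimes> (v [^] n \<otimes> v [^] n')"
        unfolding x(1) y(1) using x(2) y(2) vc by (simp add: m_ac)
      then have "x \<otimes> y = (s \<otimes> s') \<otimes> v [^] (n + n')" using vc by (simp add: nat_pow_mult)
      moreover have "s \<otimes> s' \<notin> M" using x(2,3) y(2,3) Mp.I_prime by blast
      ultimately show "x \<otimes> y \<in> S" using SI[of "s \<otimes> s'"] x(2) y(2) by simp
    qed blast
    have "d \<in> Q" using Q(2) cgenideal_self[OF dc(1)] by blast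
    then have Qmax: "maximalideal Q R" using krull_dim_1_maximalideal[OF dim Q(1)] dc(2) by blast
    then interpret Q: maximalideal Q R .
    have "Q \<subseteq> M"
    proof
      fix s assume s: "s \<in> Q"
      then have sc: "s \<in> carrier R" using Q.Icarr by blast
      show "s \<in> M" using SI[OF sc, of 0] Q(3) s sc by auto
    qed
    then have "Q = M" using Q.I_maximal[OF M.is_ideal _ M.a_subset] M.I_notcarr by blast
    moreover have "v \<in> S" using SI[OF one_closed one, of 1] vc by simp
    ultimately show False using Q(3) v by blast
  qed
  then obtain s and n :: nat where s: "s \<in> carrier R - M" "s \<otimes> v [^] n \<in> PIdl d"
    using SE by blast
  have "s \<otimes> v \<in> M'" if M': "maximalideal M' R" "d \<in> M'" for M'
  proof -
    interpret M': maximalideal M' R by (rule M'(1))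
    interpret P: primeideal M' R using maximalideal_prime[OF M'(1)] .
    have "s \<otimes> v [^] n \<in> M'" using s(2) cgenideal_minimal[OF M'.is_ideal M'(2)] by blast
    then consider "s \<in> M'" | "v [^] n \<in> M'" using P.I_prime[of s "v [^] n"] s(1) vc by auto
    then show ?thesis
    proof cases
      case 1
      then show ?thesis using M'.I_r_closed vc by blast
    next
      case 2
      have "v \<in> M'"
        using 2
      proof (induction n)
        case 0
        then show ?case using M'.one_imp_carrier M'.I_notcarr by simp
      next
        case (Suc n)
        then show ?case using P.I_prime[of "v [^] n" v] vc by auto
      qed
      then show ?thesis using M'.I_l_closed s(1) by blast
    qed
  qed
  then show ?thesis using s(1) by blast
qed

text \<open>The codes modulo \<open>N d\<close> for the countably many \<open>d\<close> in
  \<open>D\<close> determine an element: every maximal ideal contains such a \<open>d\<close>, so a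
  difference lying in all \<open>N d\<close> is in the Jacobson radical, which is zero.\<close>

lemma (in domain) carrier_lepoll_nat_set:
  assumes no: "\<nexists>S. maximal_subring S R" and dim: "krull_dim R = 1"
    and unc: "\<not> countable (carrier R)"
  shows "carrier R \<lesssim> (UNIV :: nat set set)"
proof -
  obtain K where K: "subring K R" "countable K" using countable_subring_exists by blast
  note Kc = subringE(1)[OF K(1)]
  obtain t0 where t0: "t0 \<in> carrier R" "t0 \<noteq> \<zero>" "free_over K t0"
    using free_over_exists[OF K subset_refl unc] by blast
  define D where "D = simple_extension K t0 - {\<zero>}"
  have D: "D \<subseteq> carrier R" "countable D"
    unfolding D_def using simple_extension_in_carrier[OF Kc t0(1)]
      countable_simple_extension[OF Kc K(2) t0(1)] by auto
  define V where "V d = {M. maximalideal M R \<and> d \<in> M}" for d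
  define N where "N d = {z \<in> carrier R. \<forall>M\<in>V d. z \<in> M}" for d
  have code: "\<exists>\<psi> :: 'a \<Rightarrow> nat set. \<forall>t\<in>carrier R. \<forall>t'\<in>carrier R. \<psi> t = \<psi> t' \<longrightarrow> t \<ominus> t' \<in> N d"
    if d: "d \<in> D" for d
    unfolding N_def
  proof (rule code_modulo_intersection_of_maximalideals[where e = residue_reps])
    have dc: "d \<in> carrier R" "d \<noteq> \<zero>" using d D unfolding D_def by auto
    show "maximalideal M R" if "M \<in> V d" for M using that unfolding V_def by blast
    \<comment> \<open>The element \<open>d\<close> itself lies in \<open>N d\<close>, so a maximal
      ideal containing \<open>N d\<close> contains \<open>d\<close>.\<close>
    show "M \<in> V d"
      if "maximalideal M R" "{z \<in> carrier R. \<forall>M\<in>V d. z \<in> M} \<subseteq> M" for M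
      using that dc unfolding V_def by blast
    show "V d \<lesssim> (UNIV :: nat set set)"
      by (rule lepoll_trans[OF subset_imp_lepoll maximalideals_lepoll[OF no]]) (auto simp: V_def)
    show "residue_reps M i \<in> carrier R" if "M \<in> V d" for M i
      using residue_reps(1)[OF _ no, of M] that unfolding V_def by blast
    show "\<exists>i. t \<ominus> residue_reps M i \<in> M" if M: "M \<in> V d" and t: "t \<in> carrier R" for M t
    proof -
      interpret M: maximalideal M R using M unfolding V_def by blast
      have "M +> t \<in> carrier (R Quot M)" using M.rcos_image t by blast
      then obtain i where "M +> t = M +> residue_reps M i" using residue_reps(2)[OF M.is_maximalideal no] by blast
      moreover have "residue_reps M i \<in> carrier R" using residue_reps(1)[OF M.is_maximalideal no] by blast
      ultimately show ?thesis using quotient_eq_iff_same_a_r_cos[OF M.is_ideal t] by blast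
    qed
    show "\<exists>s\<in>carrier R - M. s \<otimes> v \<in> {z \<in> carrier R. \<forall>M\<in>V d. z \<in> M}"
      if M: "M \<in> V d" and v: "v \<in> M" for M v
    proof -
      have M': "maximalideal M R" using M unfolding V_def by blast
      have vc: "v \<in> carrier R" using ideal.Icarr[OF maximalideal.axioms(1)[OF M'] v] .
      obtain s where s: "s \<in> carrier R - M" "\<forall>M'. maximalideal M' R \<and> d \<in> M' \<longrightarrow> s \<otimes> v \<in> M'"
        using krull_dim_1_multiplier[OF dim dc M' v] by blast
      then have "s \<otimes> v \<in> {z \<in> carrier R. \<forall>M\<in>V d. z \<in> M}" using vc unfolding V_def by simp
      then show ?thesis using s(1) by blast
    qed
  qed
  define \<psi> where "\<psi> d = (SOME \<psi> :: 'a \<Rightarrow> nat set.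
    \<forall>t\<in>carrier R. \<forall>t'\<in>carrier R. \<psi> t = \<psi> t' \<longrightarrow> t \<ominus> t' \<in> N d)" for d
  have \<psi>: "t \<ominus> t' \<in> N d" if "d \<in> D" "t \<in> carrier R" "t' \<in> carrier R" "\<psi> d t = \<psi> d t'" for d t t'
    using someI_ex[OF code[OF that(1)]] that(2-4) unfolding \<psi>_def by blast
  have "inj_on (\<lambda>t n. \<psi> (from_nat_into D n) t) (carrier R)"
  proof (rule inj_onI)
    fix t t' assume t: "t \<in> carrier R" "t' \<in> carrier R"
      and eq: "(\<lambda>n. \<psi> (from_nat_into D n) t) = (\<lambda>n. \<psi> (from_nat_into D n) t')"
    have "t \<ominus> t' \<in> M" if M: "maximalideal M R" for M
    proof -
      obtain d where d: "d \<in> D" "d \<in> M"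
        using maximalideal_meets_simple_extension[OF M no K(1) t0] unfolding D_def by blast
      obtain n where "from_nat_into D n = d" using from_nat_into_surj[OF D(2) d(1)] by blast
      then have "\<psi> d t = \<psi> d t'" using fun_cong[OF eq, of n] by simp
      then have "t \<ominus> t' \<in> N d" using \<psi>[OF d(1) t] by blast
      then show ?thesis unfolding N_def V_def using M d(2) by blast
    qed
    then have "t \<ominus> t' = \<zero>" using jacobson_radical_zero[OF no unc] t by blast
    then show "t = t'" using t by (simp add: r_right_minus_eq)
  qed
  then have "carrier R \<lesssim> (UNIV :: (nat \<Rightarrow> nat set) set)" unfolding lepoll_def by blast
  then show ?thesis by (rule lepoll_trans[OF _ lepoll_nat_set_fun])
qed

theorem theorem2p24:
  fixes T (structure)
  assumes "domain T"
    and "carrier T \<approx> Pow (Pow (UNIV :: nat set))"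
    and "krull_dim T = 1"
  shows "\<exists>S. maximal_subring S T"
proof (rule ccontr)
  assume no: "\<nexists>S. maximal_subring S T"
  interpret domain T by fact
  \<comment> \<open>By Cantor's theorem, since the carrier is equipollent to the power set of
    \<open>nat set\<close>.\<close>
  have large: "\<not> carrier T \<lesssim> (UNIV :: nat set set)"
  proof
    assume "carrier T \<lesssim> (UNIV :: nat set set)"
    then have "Pow (UNIV :: nat set set) \<lesssim> (UNIV :: nat set set)"
      using lepoll_trans1[OF eqpoll_sym[OF assms(2)]] by simp
    then show False using lesspoll_Pow_self[of "UNIV :: nat set set"] unfolding lesspoll_def
      by (blast intro: lepoll_antisym)
  qed
  have "\<not> countable (carrier T)"
  proof
    assume "countable (carrier T)"
    then obtain f :: "'a \<Rightarrow> nat" where "inj_on f (carrier T)" by (rule countableE)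
    then have "inj_on (\<lambda>t. {f t}) (carrier T)" by (simp add: inj_on_def)
    then show False using large unfolding lepoll_def by blast
  qed
  from carrier_lepoll_nat_set[OF no assms(3) this] show False using large by contradiction
qed

end
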